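(* For incomparable elements $p$, $q$ of a planar lattice diagram $L$, the following conditions are equivalent. (a) $p\prec_{\mathrm{lr}}q$, that is, $p$ is covered by $q$ in the order $<_{\mathrm{lr}}$; (b) $\mathrm{LocInt}(p,q)=\varnothing$; (c) $\mathrm{LocReg}(p,q)$ is an e-ladder from $p$ to $q$.
   Context: Points of $\mathbb{R}^2$ are written $u=(u_x,u_y)$, and $\overline{pq}$ is the straight line segment from $p$ to $q$; $\prec$ is the covering relation. A diagram is a finite ordered set $H$ whose elements are distinct points of $\mathbb{R}^2$ such that for each covering $p\prec q$ in $H$ we have $p_y<q_y$ and $\overline{pq}$ intersects $H$ only in $p$ and $q$. A diagram is planar if any two distinct covering segments are disjoint or intersect only at their endpoints. A planar lattice diagram $L$ is a planar diagram that is a lattice as an ordered set. For a maximal chain $C$ of $L$, the path function $f_C$ is the function whose graph $x=f_C(y)$ is the path along the covering segments of $C$; all these functions have the same real interval as domain. Maximal chains are ordered by $C_1\le C_2$ iff $f_{C_1}\le f_{C_2}$ pointwise; the set of maximal chains is a distributive lattice whose operations are given by the pointwise $\min$ and $\max$ of path functions. $\mathrm{LM}(p)$ and $\mathrm{RM}(p)$ are the least and the greatest maximal chain containing $p$. For $p\in L$ and a maximal chain $C$, $p\le_{\mathrm{pf}}C$ means $p_x\le f_C(p_y)$; the relations $p<_{\mathrm{pf}}C$, $p\ge_{\mathrm{pf}}C$, $C\le_{\mathrm{pf}}p$, and so on, are defined similarly. For $p,q\in L$, $p<_{\mathrm{lr}}q$ means that $p$ and $q$ are incomparable in $L$ and $p\le_{\mathrm{pf}}C\le_{\mathrm{pf}}q$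 for some maximal chain $C$. The relation $<_{\mathrm{lr}}$ is a strict partial order on $L$, complementary to the order $<$ of $L$ (any two distinct elements are comparable by exactly one of $<$ and $<_{\mathrm{lr}}$). For incomparable elements $p,q$ of $L$, the local region determined by $p$ and $q$ is $\mathrm{LocReg}(p,q)=\{z\in[p\wedge q,p\vee q]:\mathrm{RM}(p)\le_{\mathrm{pf}}z\le_{\mathrm{pf}}\mathrm{LM}(q)\}$. Its interior is $\mathrm{LocInt}(p,q)=\{z\in\mathrm{LocReg}(p,q):\mathrm{RM}(p)<_{\mathrm{pf}}z<_{\mathrm{pf}}\mathrm{LM}(q)\}$, its left boundary is $\mathrm{LocReg}(p,q)\cap\mathrm{RM}(p)$, and its right boundary is $\mathrm{LocReg}(p,q)\cap\mathrm{LM}(q)$. Let $\mathsf{C}_n=\{0,1,\dots,n-1\}$ with the natural order. A ladder from $p$ to $q$ is a local region $\mathrm{LocReg}(p,q)$ isomorphic to $\mathsf{C}_2\times\mathsf{C}_n$ for some $n\ge2$. More generally, an e-ladder (extended ladder) from $p$ to $q$ is a local region $\mathrm{LocReg}(p,q)$ consisting of an isomorph of $\mathsf{C}_2\times\mathsf{C}_n$ together with possible additional boundary elements; thus an e-ladder has empty interior. A rung of a ladder or e-ladder is a covering between two elements of opposite boundaries (not including top or bottom elements); an e-ladder with no rungs is called a cell.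
   Formalization: The pair is assumed oriented so that p lies to the left of q (p <_lr q); if q <_lr p then LM(q) ≤ RM(p), so LocInt(p,q) is empty while p is not covered by q in <_lr, and the stated equivalence fails. *)

theory Defs
  imports "HOL-Analysis.Line_Segment" "HOL-Algebra.Lattice"
begin

type_synonym point = "real \<times> real"

definition covered_by :: "'a set \<Rightarrow> ('a \<Rightarrow> 'a \<Rightarrow> bool) \<Rightarrow> 'a \<Rightarrow> 'a \<Rightarrow> bool" where
  "covered_by A R x y \<longleftrightarrow>
     x \<in> A \<and> y \<in> A \<and> R x y \<and> \<not> (\<exists>z\<in>A. R x z \<and> R z y)"

abbreviation covers :: "'a gorder \<Rightarrow> 'a \<Rightarrow> 'a \<Rightarrow> bool" where
  "covers L \<equiv> covered_by (carrier L) (lless L)"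

definition incomparable :: "'a gorder \<Rightarrow> 'a \<Rightarrow> 'a \<Rightarrow> bool" where
  "incomparable L p q \<longleftrightarrow> \<not> le L p q \<and> \<not> le L q p"

text \<open>
  The order of a diagram is an arbitrary one on a finite set of points; it is unrelated to any
  componentwise or lexicographic order of the plane.
\<close>

definition diagram :: "point gorder \<Rightarrow> bool" where
  "diagram H \<longleftrightarrow> partial_order H \<and> finite (carrier H) \<and>
     (\<forall>p q. covers H p q \<longrightarrow> snd p < snd q \<and> closed_segment p q \<inter> carrier H = {p, q})"

definition planar_diagram :: "point gorder \<Rightarrow> bool" where
  "planar_diagram H \<longleftrightarrow> diagram H \<and>
     (\<forall>p q r s. covers H p q \<and> covers H r s \<and> (p, q) \<noteq> (r, s) \<longrightarrow>
        closed_segment p q \<inter> closed_segment r s \<subseteq> {p, q} \<inter> {r, s})"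

definition planar_lattice_diagram :: "point gorder \<Rightarrow> bool" where
  "planar_lattice_diagram L \<longleftrightarrow> planar_diagram L \<and> lattice L"

definition maximal_chains :: "point gorder \<Rightarrow> point set set" where
  "maximal_chains L = {C. pred_on.maxchain (carrier L) (lless L) C}"

text \<open>
  Elements of a maximal chain of a finite ordered set that are consecutive in the chain form a
  covering of the whole ordered set. The summand \<open>C\<close> only matters for one-element chains.
\<close>

definition path :: "point gorder \<Rightarrow> point set \<Rightarrow> point set" where
  "path L C = C \<union> (\<Union>(a, b) \<in> {(a, b). a \<in> C \<and> b \<in> C \<and> covers L a b}. closed_segment a b)"

text \<open>The path function; it is meaningful on the interval \<open>snd ` path L C\<close> only.\<close>

definition path_fun :: "point gorder \<Rightarrow> point set \<Rightarrow> real \<Rightarrow> real" where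
  "path_fun L C y = (THE x. (x, y) \<in> path L C)"

definition chain_order :: "point gorder \<Rightarrow> point set gorder" where
  "chain_order L =
     \<lparr>carrier = maximal_chains L, eq = (=),
      le = (\<lambda>C D. \<forall>y \<in> snd ` path L C. path_fun L C y \<le> path_fun L D y)\<rparr>"

definition LM :: "point gorder \<Rightarrow> point \<Rightarrow> point set" where
  "LM L p = (THE C. least (chain_order L) C {D \<in> maximal_chains L. p \<in> D})"

definition RM :: "point gorder \<Rightarrow> point \<Rightarrow> point set" where
  "RM L p = (THE C. greatest (chain_order L) C {D \<in> maximal_chains L. p \<in> D})"

definition point_le_chain :: "point gorder \<Rightarrow> point \<Rightarrow> point set \<Rightarrow> bool" where
  "point_le_chain L p C \<longleftrightarrow> fst p \<le> path_fun L C (snd p)"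

definition chain_le_point :: "point gorder \<Rightarrow> point set \<Rightarrow> point \<Rightarrow> bool" where
  "chain_le_point L C p \<longleftrightarrow> path_fun L C (snd p) \<le> fst p"

definition point_less_chain :: "point gorder \<Rightarrow> point \<Rightarrow> point set \<Rightarrow> bool" where
  "point_less_chain L p C \<longleftrightarrow> fst p < path_fun L C (snd p)"

definition chain_less_point :: "point gorder \<Rightarrow> point set \<Rightarrow> point \<Rightarrow> bool" where
  "chain_less_point L C p \<longleftrightarrow> path_fun L C (snd p) < fst p"

definition lr_less :: "point gorder \<Rightarrow> point \<Rightarrow> point \<Rightarrow> bool" where
  "lr_less L p q \<longleftrightarrow> p \<in> carrier L \<and> q \<in> carrier L \<and> incomparable L p q \<and>
     (\<exists>C \<in> maximal_chains L. point_le_chain L p C \<and> chain_le_point L C q)"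

definition LocReg :: "point gorder \<Rightarrow> point \<Rightarrow> point \<Rightarrow> point set" where
  "LocReg L p q = {z \<in> at_least_at_most L (meet L p q) (join L p q).
     chain_le_point L (RM L p) z \<and> point_le_chain L z (LM L q)}"

definition LocInt :: "point gorder \<Rightarrow> point \<Rightarrow> point \<Rightarrow> point set" where
  "LocInt L p q = {z \<in> LocReg L p q.
     chain_less_point L (RM L p) z \<and> point_less_chain L z (LM L q)}"

definition left_boundary :: "point gorder \<Rightarrow> point \<Rightarrow> point \<Rightarrow> point set" where
  "left_boundary L p q = LocReg L p q \<inter> RM L p"

definition right_boundary :: "point gorder \<Rightarrow> point \<Rightarrow> point \<Rightarrow> point set" where
  "right_boundary L p q = LocReg L p q \<inter> LM L q"

definition C2_times_C :: "nat \<Rightarrow> (nat \<times> nat) gorder" where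
  "C2_times_C n = \<lparr>carrier = {..<2} \<times> {..<n}, eq = (=),
     le = (\<lambda>u v. fst u \<le> fst v \<and> snd u \<le> snd v)\<rparr>"

definition rung :: "point gorder \<Rightarrow> point \<Rightarrow> point \<Rightarrow> point \<Rightarrow> point \<Rightarrow> bool" where
  "rung L p q x y \<longleftrightarrow> covers L x y \<and>
     (x \<in> left_boundary L p q \<and> y \<in> right_boundary L p q \<or>
      x \<in> right_boundary L p q \<and> y \<in> left_boundary L p q) \<and>
     {x, y} \<inter> {meet L p q, join L p q} = {}"

text \<open>
  The local region consists of an isomorph \<open>f ` (C\<^sub>2 \<times> C\<^sub>n)\<close> and of additional boundary
  elements. The two copies of \<open>C\<^sub>n\<close> lie on opposite boundaries; the lower copy may be on
  either side, as rungs may ascend to the right or to the left. The additional elements only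
  subdivide the sides: the rungs are exactly the pairs \<open>f (0, i)\<close>, \<open>f (1, i)\<close> with
  \<open>0 < i < n - 1\<close>. Without the last two requirements \<open>C\<^sub>3 \<times> C\<^sub>3\<close>, which has an
  interior element, would count as an extension of \<open>C\<^sub>2 \<times> C\<^sub>2\<close>, and every region without
  interior would trivially extend the four elements \<open>p \<sqinter> q\<close>, \<open>p\<close>, \<open>q\<close>, \<open>p \<squnion> q\<close>.
\<close>

definition is_e_ladder :: "point gorder \<Rightarrow> point \<Rightarrow> point \<Rightarrow> bool" where
  "is_e_ladder L p q \<longleftrightarrow>
     (\<exists>n f. n \<ge> 2 \<and>
        f ` carrier (C2_times_C n) \<subseteq> LocReg L p q \<and>
        order_emb (C2_times_C n) L f \<and>
        LocReg L p q - f ` carrier (C2_times_C n) \<subseteq> left_boundary L p q \<union> right_boundary L p q \<and>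
        ((\<forall>i<n. f (0, i) \<in> left_boundary L p q \<and> f (1, i) \<in> right_boundary L p q) \<or>
         (\<forall>i<n. f (0, i) \<in> right_boundary L p q \<and> f (1, i) \<in> left_boundary L p q)) \<and>
        {(x, y). rung L p q x y} = {(f (0, i), f (1, i)) | i. 0 < i \<and> i + 1 < n})"

end

theory Submission
  imports Defs "HOL-Analysis.Starlike"
begin

text \<open>
  Everything rests on planarity in the following form: if two maximal chains change sides between
  two levels, then they share an element between these levels. Hence an element squeezed between
  two maximal chains through \<open>e\<close> is comparable with \<open>e\<close>.

  (a) and (b): an interior element of the local region lies strictly between \<open>p\<close> and \<open>q\<close> from left
  to right. Conversely, an element \<open>z\<close> between \<open>p\<close> and \<open>q\<close> from left to right is strictly between
  \<open>RM(p)\<close> and \<open>LM(q)\<close>. Both chains pass through \<open>p \<sqinter> q\<close> and \<open>p \<squnion> q\<close>, so \<open>z\<close> is comparable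
  with these, and then it lies between them because it is incomparable with \<open>p\<close>.

  (b) implies (c): a rung ascending from left to right starts below \<open>p\<close> and ends above \<open>q\<close>, and
  rungs of opposite directions cannot coexist. So the left side \<open>p \<sqinter> q, x\<^sub>1, x\<^sub>2, \<dots>, p\<close> and the right
  side \<open>q, y\<^sub>1, y\<^sub>2, \<dots>, p \<squnion> q\<close>, where the rungs are \<open>x\<^sub>i \<prec> y\<^sub>i\<close>, form the required copy of
  \<open>C\<^sub>2 \<times> C\<^sub>n\<close>; for the other direction the sides are exchanged.
\<close>

(* Points are pairs; quantifiers over points are not to be split into coordinates. *)
declare split_paired_All [simp del] split_paired_Ex [simp del]

subsection \<open>Maximal chains of a planar lattice diagram\<close>

lemma finite_arg_min:
  fixes f :: "'a \<Rightarrow> real"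
  assumes "finite S" "S \<noteq> {}"
  obtains a where "a \<in> S" "\<forall>z\<in>S. f a \<le> f z"
  using arg_min_if_finite(1)[OF assms, of f] arg_min_least[OF assms, of _ f] by blast

text \<open>The locale \<open>lattice\<close> admits an empty carrier. Nonemptiness makes the finite
  lattice bounded, which gives all maximal chains the same two ends.\<close>

locale planar_lattice = lattice L for L :: "point gorder" (structure) +
  assumes planar: "planar_diagram L" and nonempty: "carrier L \<noteq> {}"
begin

lemma fin: "finite (carrier L)"
  using planar by (simp add: planar_diagram_def diagram_def)

lemma cover_level: "covers L a b \<Longrightarrow> snd a < snd b"
  using planar by (simp add: planar_diagram_def diagram_def)

lemma cover_segment: "covers L a b \<Longrightarrow> closed_segment a b \<inter> carrier L = {a, b}"
  using planar by (simp add: planar_diagram_def diagram_def)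

lemma cover_planar:
  "\<lbrakk>covers L a b; covers L c d; (a, b) \<noteq> (c, d)\<rbrakk>
    \<Longrightarrow> closed_segment a b \<inter> closed_segment c d \<subseteq> {a, b} \<inter> {c, d}"
  using planar by (simp add: planar_diagram_def)

lemma coversI:
  "\<lbrakk>a \<in> carrier L; b \<in> carrier L; a \<sqsubset> b; \<And>z. z \<in> carrier L \<Longrightarrow> a \<sqsubset> z \<Longrightarrow> z \<sqsubset> b \<Longrightarrow> False\<rbrakk>
    \<Longrightarrow> covers L a b"
  by (auto simp: covered_by_def)

lemma covers_between:
  "\<lbrakk>covers L a b; z \<in> carrier L; a \<sqsubseteq> z; z \<sqsubseteq> b\<rbrakk> \<Longrightarrow> z = a \<or> z = b"
  unfolding covered_by_def lless_eq by metis

text \<open>The height condition is given for coverings only. Induction on the size of the interval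
  extends it: a pair that is not a covering is split at an intermediate element into two smaller
  intervals.\<close>

lemma less_level:
  assumes "a \<in> carrier L" "b \<in> carrier L" "a \<sqsubseteq> b" "a \<noteq> b"
  shows "snd a < snd b"
  using assms
proof (induction "card {z \<in> carrier L. a \<sqsubseteq> z \<and> z \<sqsubseteq> b}" arbitrary: a b rule: less_induct)
  case less
  let ?I = "\<lambda>a b. {z \<in> carrier L. a \<sqsubseteq> z \<and> z \<sqsubseteq> b}"
  show ?case
  proof (cases "covers L a b")
    case False
    then obtain z where z: "z \<in> carrier L" "a \<sqsubseteq> z" "a \<noteq> z" "z \<sqsubseteq> b" "z \<noteq> b"
      using less.prems by (auto simp: covered_by_def lless_eq)
    have "?I a z \<subset> ?I a b" "?I z b \<subset> ?I a b"
      using z less.prems le_trans le_antisym by blast+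
    then have "card (?I a z) < card (?I a b)" "card (?I z b) < card (?I a b)"
      using fin by (auto intro!: psubset_card_mono)
    then have "snd a < snd z" "snd z < snd b"
      using less.hyps z less.prems by auto
    then show ?thesis by simp
  qed (rule cover_level)
qed

lemma le_level: "\<lbrakk>a \<in> carrier L; b \<in> carrier L; a \<sqsubseteq> b\<rbrakk> \<Longrightarrow> snd a \<le> snd b"
  using less_level[of a b] by (cases "a = b") auto

end

text \<open>The meet of a lowest point with any \<open>z\<close> cannot be lower still, so it is
  that point itself; dually for a highest point and joins.\<close>

sublocale planar_lattice \<subseteq> bounded_lattice
proof
  obtain a where a: "a \<in> carrier L" "\<forall>z\<in>carrier L. snd a \<le> snd z"
    using finite_arg_min[OF fin nonempty, of snd] by blast
  obtain b where b: "b \<in> carrier L" "\<forall>z\<in>carrier L. - snd b \<le> - snd z"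
    using finite_arg_min[OF fin nonempty, of "\<lambda>z. - snd z"] by blast
  have "a \<sqsubseteq> z" if "z \<in> carrier L" for z
    using a that less_level[of "a \<sqinter> z" a] meet_left[of a z] meet_right[of a z] meet_closed[of a z]
    by (metis not_less)
  then show "\<exists>x. least L x (carrier L)"
    using a(1) by (intro exI[of _ a]) (simp add: least_def Lower_def subset_iff)
  have "z \<sqsubseteq> b" if "z \<in> carrier L" for z
    using b that less_level[of b "b \<squnion> z"] join_left[of b z] join_right[of b z] join_closed[of b z]
    by (metis not_less neg_le_iff_le)
  then show "\<exists>x. greatest L x (carrier L)"
    using b(1) by (intro exI[of _ b]) (simp add: greatest_def Upper_def subset_iff)
qed

context planar_lattice
begin

text \<open>Every maximal chain runs from \<open>\<bottom>\<close> to \<open>\<top>\<close>, so this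
  interval is the common domain of all path functions.\<close>

abbreviation levels :: "real set" where
  "levels \<equiv> {snd \<bottom>..snd \<top>}"

abbreviation chains :: "point set set" where
  "chains \<equiv> maximal_chains L"

lemma level_in_levels [simp]: "z \<in> carrier L \<Longrightarrow> snd z \<in> levels"
  using le_level bottom_closed top_closed bottom_lower top_higher by simp

lemma chains_subset: "C \<in> chains \<Longrightarrow> C \<subseteq> carrier L"
  by (simp add: maximal_chains_def pred_on.maxchain_def pred_on.chain_def)

lemma chains_carrier: "\<lbrakk>C \<in> chains; x \<in> C\<rbrakk> \<Longrightarrow> x \<in> carrier L"
  using chains_subset by blast

lemma chains_finite: "C \<in> chains \<Longrightarrow> finite C"
  using chains_subset fin finite_subset by blast

lemma chain_iff:
  "pred_on.chain (carrier L) (lless L) K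
    \<longleftrightarrow> K \<subseteq> carrier L \<and> (\<forall>x\<in>K. \<forall>y\<in>K. x \<sqsubseteq> y \<or> y \<sqsubseteq> x)"
proof -
  have "(lless L)\<^sup>=\<^sup>= x y \<longleftrightarrow> x \<sqsubseteq> y" if "x \<in> carrier L" for x y
    using that by (auto simp: lless_eq)
  then show ?thesis
    unfolding pred_on.chain_def
    by (intro conj_cong refl ball_cong) (simp_all add: subset_iff)
qed

lemma chains_total: "\<lbrakk>C \<in> chains; x \<in> C; y \<in> C\<rbrakk> \<Longrightarrow> x \<sqsubseteq> y \<or> y \<sqsubseteq> x"
  by (simp add: maximal_chains_def pred_on.maxchain_def chain_iff)

lemma chains_level_le:
  "\<lbrakk>C \<in> chains; x \<in> C; y \<in> C\<rbrakk> \<Longrightarrow> x \<sqsubseteq> y \<longleftrightarrow> snd x \<le> snd y"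
  using chains_total less_level chains_carrier le_level by (metis not_le)

lemma chains_level_inj: "\<lbrakk>C \<in> chains; x \<in> C; y \<in> C; snd x = snd y\<rbrakk> \<Longrightarrow> x = y"
  using chains_level_le[of C x y] chains_level_le[of C y x] chains_carrier[of C] le_antisym
  by simp

lemma chains_maximal:
  assumes "C \<in> chains" "z \<in> carrier L" "\<And>c. c \<in> C \<Longrightarrow> c \<sqsubseteq> z \<or> z \<sqsubseteq> c"
  shows "z \<in> C"
proof (rule ccontr)
  assume "z \<notin> C"
  moreover have "pred_on.chain (carrier L) (lless L) (insert z C)"
    using assms chains_total[OF assms(1)] chains_subset[OF assms(1)] by (auto simp: chain_iff)
  ultimately show False
    using assms(1) by (auto simp: maximal_chains_def pred_on.maxchain_def)
qed

lemma chainsI: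
  assumes "C \<subseteq> carrier L" "\<And>x y. \<lbrakk>x \<in> C; y \<in> C\<rbrakk> \<Longrightarrow> x \<sqsubseteq> y \<or> y \<sqsubseteq> x"
    "\<And>z. \<lbrakk>z \<in> carrier L; \<And>c. c \<in> C \<Longrightarrow> c \<sqsubseteq> z \<or> z \<sqsubseteq> c\<rbrakk> \<Longrightarrow> z \<in> C"
  shows "C \<in> chains"
proof -
  have "\<not> (pred_on.chain (carrier L) (lless L) S \<and> C \<subset> S)" for S
    using assms(3) by (simp add: chain_iff) (meson psubsetE subset_iff)
  then show ?thesis
    using assms(1,2) by (simp add: maximal_chains_def pred_on.maxchain_def chain_iff)
qed

lemma chain_extend:
  assumes "K \<subseteq> carrier L" "\<And>x y. \<lbrakk>x \<in> K; y \<in> K\<rbrakk> \<Longrightarrow> x \<sqsubseteq> y \<or> y \<sqsubseteq> x"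
  obtains C where "C \<in> chains" "K \<subseteq> C"
proof -
  let ?S = "{S. pred_on.chain (carrier L) (lless L) S}"
  have "finite ?S"
    by (rule finite_subset[of _ "Pow (carrier L)"]) (auto simp: fin chain_iff)
  moreover have "K \<in> ?S"
    using assms by (auto simp: chain_iff)
  ultimately obtain C where "C \<in> ?S" "K \<subseteq> C" "\<forall>S\<in>?S. C \<subseteq> S \<longrightarrow> C = S"
    using finite_has_maximal2[of ?S K] by blast
  then have "C \<in> chains"
    by (auto simp: maximal_chains_def pred_on.maxchain_def)
  with \<open>K \<subseteq> C\<close> show ?thesis using that by blast
qed

lemma chain_through2:
  assumes "a \<in> carrier L" "b \<in> carrier L" "a \<sqsubseteq> b"
  obtains C where "C \<in> chains" "a \<in> C" "b \<in> C"
  using chain_extend[of "{a, b}"] assms by auto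

lemma chain_through:
  assumes "a \<in> carrier L"
  obtains C where "C \<in> chains" "a \<in> C"
  using chain_through2[of a a] assms by auto

lemma bottom_in_chain [simp]: "C \<in> chains \<Longrightarrow> \<bottom> \<in> C"
  by (rule chains_maximal) (auto simp: bottom_lower chains_carrier)

lemma top_in_chain [simp]: "C \<in> chains \<Longrightarrow> \<top> \<in> C"
  by (rule chains_maximal) (auto simp: top_higher chains_carrier)

text \<open>An element strictly between \<open>a\<close> and \<open>b\<close> would be comparable
  with all of \<open>C\<close>, since each element of \<open>C\<close> is below \<open>a\<close> or
  above \<open>b\<close>. By maximality it would lie in \<open>C\<close>, at a forbidden
  height.\<close>

lemma consecutive_covers:
  assumes "C \<in> chains" "a \<in> C" "b \<in> C" "snd a < snd b"
    "\<And>c. c \<in> C \<Longrightarrow> snd c \<le> snd a \<or> snd b \<le> snd c"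
  shows "covers L a b"
proof (rule coversI)
  show "a \<in> carrier L" "b \<in> carrier L"
    using assms chains_carrier by auto
  show "a \<sqsubset> b"
    using assms chains_level_le[of C a b] by (auto simp: lless_eq)
  fix z assume z: "z \<in> carrier L" "a \<sqsubset> z" "z \<sqsubset> b"
  have "z \<in> C"
  proof (rule chains_maximal)
    fix c assume c: "c \<in> C"
    then have "c \<sqsubseteq> a \<or> b \<sqsubseteq> c"
      using assms(5)[OF c] chains_level_le assms(1-3) by blast
    then show "c \<sqsubseteq> z \<or> z \<sqsubseteq> c"
      using z c assms chains_carrier[OF assms(1)] le_trans by (metis lless_imp_le)
  qed (use assms z in auto)
  moreover have "snd a < snd z" "snd z < snd b"
    using z less_level[of a z] less_level[of z b] assms(1-3) chains_carrier[OF assms(1)]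
    by (simp_all add: lless_eq)
  ultimately show False
    using assms(5)[of z] by simp
qed

subsection \<open>Paths and path functions\<close>

lemma segment_level:
  fixes a b :: point
  assumes "(x, t) \<in> closed_segment a b" "snd a < snd b"
  shows "snd a \<le> t" "t \<le> snd b" "t = snd a \<Longrightarrow> (x, t) = a" "t = snd b \<Longrightarrow> (x, t) = b"
    "x = fst a + (t - snd a) / (snd b - snd a) * (fst b - fst a)"
proof -
  obtain u where u: "0 \<le> u" "u \<le> 1" "(x, t) = (1 - u) *\<^sub>R a + u *\<^sub>R b"
    using assms(1) by (auto simp: closed_segment_def)
  then have t: "t = snd a + u * (snd b - snd a)" and x: "x = fst a + u * (fst b - fst a)"
    by (auto simp: prod_eq_iff algebra_simps)
  have "0 \<le> u * (snd b - snd a)" "u * (snd b - snd a) \<le> snd b - snd a"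
    using u assms(2) by (auto simp: mult_left_le_one_le)
  then show "snd a \<le> t" "t \<le> snd b" using t by auto
  have "u = (t - snd a) / (snd b - snd a)"
    using t assms(2) by simp
  then show x': "x = fst a + (t - snd a) / (snd b - snd a) * (fst b - fst a)"
    using x by simp
  show "t = snd a \<Longrightarrow> (x, t) = a" "t = snd b \<Longrightarrow> (x, t) = b"
    using x' assms(2) by (auto simp: prod_eq_iff)
qed

lemma segment_at_level:
  fixes a b :: point
  assumes "snd a < snd b" "snd a \<le> t" "t \<le> snd b"
  obtains x where "(x, t) \<in> closed_segment a b"
proof -
  define u where "u = (t - snd a) / (snd b - snd a)"
  have "u * (snd b - snd a) = t - snd a" "0 \<le> u" "u \<le> 1"
    using assms by (auto simp: u_def)
  then have "(fst ((1 - u) *\<^sub>R a + u *\<^sub>R b), t) \<in> closed_segment a b"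
    by (auto simp: closed_segment_def prod_eq_iff algebra_simps intro!: exI[of _ u])
  then show thesis by (rule that)
qed

lemma path_segment:
  "\<lbrakk>a \<in> C; b \<in> C; covers L a b; z \<in> closed_segment a b\<rbrakk> \<Longrightarrow> z \<in> path L C"
  unfolding path_def by blast

lemma path_cases:
  assumes "C \<in> chains" "(x, t) \<in> path L C"
  obtains (vertex) "(x, t) \<in> C"
  | (edge) a b where "a \<in> C" "b \<in> C" "covers L a b" "(x, t) \<in> closed_segment a b"
      "snd a < t" "t < snd b"
proof (cases "(x, t) \<in> C")
  case False
  then obtain a b where ab: "a \<in> C" "b \<in> C" "covers L a b" "(x, t) \<in> closed_segment a b"
    using assms(2) by (auto simp: path_def)
  then show ?thesis
    using edge[of a b] segment_level[of x t a b] cover_level[of a b] False by force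
qed (rule vertex)

text \<open>The highest element of \<open>C\<close> at or below level \<open>t\<close> and the
  lowest one at or above it are equal or consecutive, so an element or a covering segment meets the
  level.\<close>

lemma path_exists:
  assumes C: "C \<in> chains" and t: "t \<in> levels"
  obtains x where "(x, t) \<in> path L C"
proof -
  have "\<bottom> \<in> {c \<in> C. snd c \<le> t}" "\<top> \<in> {c \<in> C. t \<le> snd c}"
    using C t by auto
  then have ne: "{c \<in> C. snd c \<le> t} \<noteq> {}" "{c \<in> C. t \<le> snd c} \<noteq> {}"
    by blast+
  have fins: "finite {c \<in> C. snd c \<le> t}" "finite {c \<in> C. t \<le> snd c}"
    using chains_finite[OF C] by auto
  \<comment> \<open>Minimizing the negative height selects the highest element.\<close>
  obtain a where aa: "a \<in> {c \<in> C. snd c \<le> t}" "\<forall>c\<in>{c \<in> C. snd c \<le> t}. - snd a \<le> - snd c"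
    by (rule finite_arg_min[OF fins(1) ne(1), of "\<lambda>z. - snd z"])
  obtain b where bb: "b \<in> {c \<in> C. t \<le> snd c}" "\<forall>c\<in>{c \<in> C. t \<le> snd c}. snd b \<le> snd c"
    by (rule finite_arg_min[OF fins(2) ne(2), of snd])
  from aa bb have a: "a \<in> C" "snd a \<le> t" "\<And>c. c \<in> C \<Longrightarrow> snd c \<le> t \<Longrightarrow> snd c \<le> snd a"
    and b: "b \<in> C" "t \<le> snd b" "\<And>c. c \<in> C \<Longrightarrow> t \<le> snd c \<Longrightarrow> snd b \<le> snd c"
    by simp_all
  show ?thesis
  proof (cases "snd a = t")
    case True
    then show ?thesis
      using a that[of "fst a"] by (auto simp: path_def)
  next
    case False
    then have lt: "snd a < snd b" using a b by auto
    have cov: "covers L a b"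
    proof (rule consecutive_covers[OF C a(1) b(1) lt])
      show "snd c \<le> snd a \<or> snd b \<le> snd c" if "c \<in> C" for c
        using a(3)[OF that] b(3)[OF that] by linarith
    qed
    obtain x where "(x, t) \<in> closed_segment a b"
      using segment_at_level[OF lt] a b by blast
    then show thesis
      using that path_segment a(1) b(1) cov by blast
  qed
qed

lemma path_level:
  assumes "C \<in> chains" "(x, t) \<in> path L C"
  shows "t \<in> levels"
  using assms
proof (cases rule: path_cases)
  case vertex
  then show ?thesis using chains_carrier[OF assms(1)] level_in_levels by force
next
  case (edge a b)
  then show ?thesis
    using chains_carrier[OF assms(1)] level_in_levels[of a] level_in_levels[of b] by auto
qed

lemma no_vertex_inside:
  assumes C: "C \<in> chains" and "c \<in> C" "a \<in> C" "b \<in> C" "covers L a b"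
    and "snd a < snd c" "snd c < snd b"
  shows False
proof -
  have "a \<sqsubseteq> c" "c \<sqsubseteq> b"
    using chains_level_le[OF C] assms by simp_all
  then have "c = a \<or> c = b"
    using covers_between[of a b c] assms chains_carrier[OF C] by simp
  then show False using assms by auto
qed

lemma path_unique:
  assumes C: "C \<in> chains" and "(x, t) \<in> path L C" "(x', t) \<in> path L C"
  shows "x = x'"
proof -
  note no_vertex = no_vertex_inside[OF C]
  from assms(1,2) show ?thesis
  proof (cases rule: path_cases)
    case vertex
    from assms(1,3) show ?thesis
    proof (cases rule: path_cases)
      case vertex': vertex
      then show ?thesis using vertex chains_level_inj[OF C, of "(x,t)" "(x',t)"] by simp
    next
      case (edge a b)
      then show ?thesis using no_vertex[of "(x,t)" a b] vertex by simp
    qed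
  next
    case e: (edge a b)
    from assms(1,3) show ?thesis
    proof (cases rule: path_cases)
      case vertex
      then show ?thesis using no_vertex[of "(x',t)" a b] e by simp
    next
      case (edge c d)
      \<comment> \<open>Both edges straddle level \<open>t\<close>. An end of one strictly inside
        the other in height would be a vertex of \<open>C\<close> inside a covering, so the edges
        coincide, and the level determines the point on them.\<close>
      have "\<not> snd a < snd c" "\<not> snd c < snd a" "\<not> snd b < snd d" "\<not> snd d < snd b"
        using no_vertex[of c a b] no_vertex[of a c d] no_vertex[of b c d] no_vertex[of d a b] e edge
        by auto
      then have "c = a" "d = b"
        using chains_level_inj[OF C] e(1,2) edge(1,2) by (metis linorder_neqE_linordered_idom)+
      then show ?thesis
        using segment_level(5)[of x t a b] segment_level(5)[of x' t a b] e edge by simp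
    qed
  qed
qed

abbreviation pf :: "point set \<Rightarrow> real \<Rightarrow> real" where
  "pf \<equiv> path_fun L"

lemma path_fun_eq: "\<lbrakk>C \<in> chains; (x, t) \<in> path L C\<rbrakk> \<Longrightarrow> pf C t = x"
  unfolding path_fun_def using path_unique by blast

lemma path_fun_in_path: "\<lbrakk>C \<in> chains; t \<in> levels\<rbrakk> \<Longrightarrow> (pf C t, t) \<in> path L C"
  using path_exists[of C t] path_fun_eq by metis

lemma path_eq_graph: "C \<in> chains \<Longrightarrow> path L C = (\<lambda>t. (pf C t, t)) ` levels"
  using path_level path_fun_eq path_fun_in_path by (fastforce simp: image_iff)

lemma snd_path: "C \<in> chains \<Longrightarrow> snd ` path L C = levels"
  by (simp add: path_eq_graph image_image)

text \<open>This rests on the diagram condition that a covering segment contains no elements besides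
  its ends.\<close>

lemma path_carrier: "\<lbrakk>z \<in> carrier L; z \<in> path L C\<rbrakk> \<Longrightarrow> z \<in> C"
proof -
  assume z: "z \<in> carrier L" "z \<in> path L C"
  then consider "z \<in> C" | a b where "a \<in> C" "b \<in> C" "covers L a b" "z \<in> closed_segment a b"
    unfolding path_def by blast
  then show "z \<in> C"
  proof cases
    case 2
    then have "z \<in> {a, b}"
      unfolding cover_segment[OF 2(3), symmetric] using z(1) by blast
    then show ?thesis using 2 by blast
  qed
qed

text \<open>With this, positions of elements relative to chains can be treated by equations and
  inequalities between reals.\<close>

lemma in_chain_iff:
  assumes "C \<in> chains" "z \<in> carrier L"
  shows "z \<in> C \<longleftrightarrow> pf C (snd z) = fst z"
proof
  show "z \<in> C \<Longrightarrow> pf C (snd z) = fst z"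
    using assms by (auto intro!: path_fun_eq simp: path_def)
  show "pf C (snd z) = fst z \<Longrightarrow> z \<in> C"
    using path_carrier[of z C] assms path_fun_in_path[of C "snd z"] level_in_levels[of z]
    by (metis prod.collapse)
qed

lemma path_fun_inj:
  assumes "C \<in> chains" "D \<in> chains" "\<And>t. t \<in> levels \<Longrightarrow> pf C t = pf D t"
  shows "C = D"
proof -
  have "z \<in> C \<longleftrightarrow> z \<in> D" if "z \<in> carrier L" for z
    using in_chain_iff[OF _ that] assms level_in_levels[OF that] by metis
  then show ?thesis using chains_subset assms by blast
qed

section \<open>Continuity and crossing of paths\<close>

lemma compact_path: "C \<in> chains \<Longrightarrow> compact (path L C)"
proof -
  assume C: "C \<in> chains"
  then have "finite {(a, b). a \<in> C \<and> b \<in> C \<and> covers L a b}"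
    using chains_finite by (auto intro: finite_subset[of _ "C \<times> C"])
  then show ?thesis
    unfolding path_def
  proof (intro compact_Un compact_UN)
    show "compact C"
      using C by (simp add: chains_finite finite_imp_compact)
  qed auto
qed

text \<open>The compact path is, up to exchanging coordinates, the graph of the path function, and a
  function into a compact set with closed graph is continuous.\<close>

lemma continuous_path_fun:
  assumes "C \<in> chains"
  shows "continuous_on levels (pf C)"
proof (rule continuous_from_closed_graph[of "fst ` path L C"])
  show "compact (fst ` path L C)"
    by (intro compact_continuous_image compact_path assms continuous_intros)
  show "pf C \<in> levels \<rightarrow> fst ` path L C"
    using assms by (force simp: path_eq_graph)
  have "(\<lambda>t. (t, pf C t)) ` levels = (\<lambda>z. (snd z, fst z)) ` path L C"
    using assms by (simp add: path_eq_graph image_image)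
  moreover have "compact ((\<lambda>z. (snd z, fst z)) ` path L C)"
    by (intro compact_continuous_image compact_path assms continuous_intros)
  ultimately show "closed ((\<lambda>t. (t, pf C t)) ` levels)"
    by (simp add: compact_imp_closed)
qed

text \<open>This is where planarity of the segments enters. Paths meet either at a common element,
  and then \<open>a = b\<close>, or inside a covering segment, which must belong to both chains and
  has the ends \<open>a\<close> and \<open>b\<close>.\<close>

lemma path_meet:
  assumes C: "C \<in> chains" and D: "D \<in> chains" and t: "t \<in> levels" and eq: "pf C t = pf D t"
  obtains a b where "a \<in> C \<inter> D" "b \<in> C \<inter> D" "snd a \<le> t" "t \<le> snd b"
    "\<And>s. \<lbrakk>snd a \<le> s; s \<le> snd b\<rbrakk> \<Longrightarrow> pf C s = pf D s"
proof -
  let ?z = "(pf C t, t)"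
  have zC: "?z \<in> path L C" and zD: "?z \<in> path L D"
    using path_fun_in_path[OF _ t] C D eq by metis+
  have triv: "?z \<in> C \<inter> D \<Longrightarrow> thesis"
    by (rule that[of ?z ?z]) (use eq in auto)
  from C zC show thesis
  proof (cases rule: path_cases)
    case vertex
    then show thesis using triv path_carrier zD chains_carrier[OF C] by blast
  next
    case e: (edge a b)
    from D zD show thesis
    proof (cases rule: path_cases)
      case vertex
      then show thesis using triv path_carrier zC chains_carrier[OF D] by blast
    next
      case (edge c d)
      show thesis
      proof (cases "(a, b) = (c, d)")
        case True
        show thesis
        proof (rule that[of a b])
          fix s assume s: "snd a \<le> s" "s \<le> snd b"
          have "a \<in> carrier L" "b \<in> carrier L"
            using e C chains_carrier by auto
          then have "s \<in> levels"
            using s level_in_levels[of a] level_in_levels[of b] by simp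
          obtain x where "(x, s) \<in> closed_segment a b"
            using segment_at_level[OF cover_level[OF e(3)]] s by blast
          then have "(x, s) \<in> path L C \<inter> path L D"
            using path_segment e(1-3) edge(1-3) True by blast
          then show "pf C s = pf D s"
            using path_fun_eq C D by blast
        qed (use e edge True in auto)
      next
        case False
        then have "?z \<in> {a, b} \<inter> {c, d}"
          using cover_planar[OF e(3) edge(3)] e edge by blast
        then show thesis using triv e edge by auto
      qed
    qed
  qed
qed

text \<open>The intermediate value theorem yields a level where the paths agree, and
  \<open>path_meet\<close> turns it into common elements.\<close>

lemma crossing:
  assumes C: "C \<in> chains" and D: "D \<in> chains" and s: "s \<in> levels" and t: "t \<in> levels"
    and lt: "pf C s < pf D s" and ge: "pf D t \<le> pf C t"
  obtains e where "e \<in> C" "e \<in> D" "min s t \<le> snd e" "snd e \<le> max s t"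
proof -
  define g where "g = (\<lambda>y. pf C y - pf D y)"
  have sub: "{min s t..max s t} \<subseteq> levels"
    using s t by auto
  have cont: "continuous_on {min s t..max s t} g"
    unfolding g_def using continuous_path_fun C D sub
    by (intro continuous_on_diff) (blast intro: continuous_on_subset)+
  have "\<exists>y\<ge>min s t. y \<le> max s t \<and> g y = 0"
  proof (cases "s \<le> t")
    case True
    then show ?thesis using IVT'[of g s 0 t] cont lt ge by (auto simp: g_def)
  next
    case False
    then show ?thesis using IVT2'[of g s 0 t] cont lt ge by (auto simp: g_def)
  qed
  then obtain y where y: "min s t \<le> y" "y \<le> max s t" "pf C y = pf D y"
    by (auto simp: g_def)
  have "y \<in> levels"
    using y sub by auto
  then obtain a b where ab: "a \<in> C \<inter> D" "b \<in> C \<inter> D" "snd a \<le> y" "y \<le> snd b"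
    "\<And>s. \<lbrakk>snd a \<le> s; s \<le> snd b\<rbrakk> \<Longrightarrow> pf C s = pf D s"
    by (rule path_meet[OF C D _ y(3)]) blast
  \<comment> \<open>The paths differ at level \<open>s\<close>, so \<open>s\<close> is outside the
    stretch from \<open>a\<close> to \<open>b\<close>, where they agree. The end of the stretch
    nearer to \<open>s\<close> is between \<open>s\<close> and \<open>y\<close> in height.\<close>
  have "s < snd a \<or> snd b < s"
    using ab(5)[of s] lt by force
  then show thesis
  proof
    assume "s < snd a"
    then show thesis using that[of a] ab y by auto
  next
    assume "snd b < s"
    then show thesis using that[of b] ab y by auto
  qed
qed

end

subsection \<open>Leftmost and rightmost chains\<close>

text \<open>An element with the fewest \<open>R\<close>-predecessors works: if it failed for some
  \<open>y\<close>, the element supplied by \<open>step\<close> would be strictly lower and have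
  fewer predecessors.\<close>

lemma finite_least_exists:
  assumes "finite S" "S \<noteq> {}" and refl: "\<And>x. R x x"
    and trans: "\<And>x y z. R x y \<Longrightarrow> R y z \<Longrightarrow> R x z"
    and step: "\<And>x y. \<lbrakk>x \<in> S; y \<in> S; \<not> R x y\<rbrakk> \<Longrightarrow> \<exists>z\<in>S. R z x \<and> \<not> R x z"
  obtains x where "x \<in> S" "\<And>y. y \<in> S \<Longrightarrow> R x y"
proof -
  obtain x where x: "x \<in> S" and "\<forall>z\<in>S. real (card {y \<in> S. R y x}) \<le> real (card {y \<in> S. R y z})"
    using finite_arg_min[OF assms(1,2), of "\<lambda>x. real (card {y \<in> S. R y x})"] by blast
  then have min: "\<And>z. z \<in> S \<Longrightarrow> card {y \<in> S. R y x} \<le> card {y \<in> S. R y z}"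
    by simp
  have "R x y" if y: "y \<in> S" for y
  proof (rule ccontr)
    assume "\<not> R x y"
    then obtain z where z: "z \<in> S" "R z x" "\<not> R x z"
      using step[OF x y] by blast
    have "{y \<in> S. R y z} \<subset> {y \<in> S. R y x}"
      using z x trans refl by blast
    then have "card {y \<in> S. R y z} < card {y \<in> S. R y x}"
      using assms(1) by (intro psubset_card_mono) auto
    with min[OF z(1)] show False by simp
  qed
  with x show thesis using that by blast
qed

context planar_lattice
begin

section \<open>Splicing two chains\<close>

lemma path_fun_cong:
  assumes C: "C \<in> chains" and E: "E \<in> chains" and ab: "a \<in> C" "b \<in> C"
    and sub: "\<And>c. \<lbrakk>c \<in> C; snd a \<le> snd c; snd c \<le> snd b\<rbrakk> \<Longrightarrow> c \<in> E"
    and t: "snd a \<le> t" "t \<le> snd b"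
  shows "pf E t = pf C t"
proof (rule path_fun_eq[OF E])
  have "a \<in> carrier L" "b \<in> carrier L"
    using ab C chains_carrier by auto
  then have "t \<in> levels"
    using t level_in_levels[of a] level_in_levels[of b] by simp
  with C have "(pf C t, t) \<in> path L C"
    by (rule path_fun_in_path)
  with C show "(pf C t, t) \<in> path L E"
  proof (cases rule: path_cases)
    case vertex
    then show ?thesis using sub t by (auto simp: path_def)
  next
    case (edge c d)
    have between: "\<not> (snd c < snd e \<and> snd e < snd d)" if "e \<in> C" for e
      using no_vertex_inside[OF C that] edge by blast
    have "snd a \<le> snd c" "snd d \<le> snd b"
      using between[OF ab(1)] between[OF ab(2)] edge t by auto
    then have "c \<in> E" "d \<in> E"
      using sub edge t by auto
    then show ?thesis
      using path_segment edge(3,4) by blast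
  qed
qed

text \<open>A local substitute for the minimum or maximum of two path functions: the stretch of
  \<open>C\<close> between the common elements nearest to level \<open>t\<close> is replaced by that
  of \<open>D\<close>. There \<open>D\<close> stays on one side of \<open>C\<close>, so
  \<open>E\<close> departs from \<open>C\<close> only to that side.\<close>

lemma chains_splice:
  assumes C: "C \<in> chains" and D: "D \<in> chains" and p: "p \<in> C" "p \<in> D"
    and t: "t \<in> levels" and ne: "pf C t \<noteq> pf D t"
  obtains E where "E \<in> chains" "p \<in> E" "pf E t = pf D t"
    "\<And>s. s \<in> levels \<Longrightarrow> pf E s = pf C s \<or>
        pf E s = pf D s \<and> (pf C s < pf D s \<longleftrightarrow> pf C t < pf D t)"
proof -
  have "\<bottom> \<in> {c \<in> C \<inter> D. snd c \<le> t}" "\<top> \<in> {c \<in> C \<inter> D. t \<le> snd c}"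
    using C D t by auto
  then have nonempty: "{c \<in> C \<inter> D. snd c \<le> t} \<noteq> {}" "{c \<in> C \<inter> D. t \<le> snd c} \<noteq> {}"
    by blast+
  have fins: "finite {c \<in> C \<inter> D. snd c \<le> t}" "finite {c \<in> C \<inter> D. t \<le> snd c}"
    using chains_finite[OF C] by auto
  obtain a where aa:
    "a \<in> {c \<in> C \<inter> D. snd c \<le> t}" "\<forall>c\<in>{c \<in> C \<inter> D. snd c \<le> t}. - snd a \<le> - snd c"
    by (rule finite_arg_min[OF fins(1) nonempty(1), of "\<lambda>z. - snd z"])
  obtain b where bb:
    "b \<in> {c \<in> C \<inter> D. t \<le> snd c}" "\<forall>c\<in>{c \<in> C \<inter> D. t \<le> snd c}. snd b \<le> snd c"
    by (rule finite_arg_min[OF fins(2) nonempty(2), of snd])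
  from aa bb have a: "a \<in> C" "a \<in> D" "snd a \<le> t"
      "\<And>c. c \<in> C \<Longrightarrow> c \<in> D \<Longrightarrow> snd c \<le> t \<Longrightarrow> snd c \<le> snd a"
    and b: "b \<in> C" "b \<in> D" "t \<le> snd b"
      "\<And>c. c \<in> C \<Longrightarrow> c \<in> D \<Longrightarrow> t \<le> snd c \<Longrightarrow> snd b \<le> snd c"
    by simp_all
  have carr: "a \<in> carrier L" "b \<in> carrier L"
    using a b C chains_carrier by auto
  have ab: "a \<sqsubseteq> b"
    using a b chains_level_le[OF C] by auto
  define E where "E = {c \<in> C. c \<sqsubseteq> a \<or> b \<sqsubseteq> c} \<union> {d \<in> D. a \<sqsubseteq> d \<and> d \<sqsubseteq> b}"
  have EL: "E \<subseteq> carrier L"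
    using chains_subset C D by (auto simp: E_def)
  have mixed: "x \<sqsubseteq> y \<or> y \<sqsubseteq> x"
    if "x \<in> C" "x \<sqsubseteq> a \<or> b \<sqsubseteq> x" "y \<in> D" "a \<sqsubseteq> y" "y \<sqsubseteq> b" for x y
    using that le_trans[of x a y] le_trans[of y b x] carr
      chains_carrier[OF C] chains_carrier[OF D] by blast
  have E: "E \<in> chains"
  proof (rule chainsI[OF EL])
    fix x y assume "x \<in> E" "y \<in> E"
    then show "x \<sqsubseteq> y \<or> y \<sqsubseteq> x"
      unfolding E_def
      using chains_total[OF C, of x y] chains_total[OF D, of x y] mixed[of x y] mixed[of y x]
      by blast
  next
    fix z assume z: "z \<in> carrier L" and comp: "\<And>c. c \<in> E \<Longrightarrow> c \<sqsubseteq> z \<or> z \<sqsubseteq> c"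
    have abE: "a \<in> E" "b \<in> E"
      using a b carr by (auto simp: E_def)
    consider "z \<sqsubseteq> a" | "b \<sqsubseteq> z" | "a \<sqsubseteq> z" "z \<sqsubseteq> b"
      using comp abE by blast
    then show "z \<in> E"
    proof cases
      case 1
      have "z \<in> C"
      proof (rule chains_maximal[OF C z])
        fix c assume c: "c \<in> C"
        show "c \<sqsubseteq> z \<or> z \<sqsubseteq> c"
          using comp[of c] chains_total[OF C c a(1)] c 1 z carr chains_carrier[OF C c] le_trans
          unfolding E_def by blast
      qed
      then show ?thesis using 1 by (simp add: E_def)
    next
      case 2
      have "z \<in> C"
      proof (rule chains_maximal[OF C z])
        fix c assume c: "c \<in> C"
        show "c \<sqsubseteq> z \<or> z \<sqsubseteq> c"
          using comp[of c] chains_total[OF C c b(1)] c 2 z carr chains_carrier[OF C c] le_trans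
          unfolding E_def by blast
      qed
      then show ?thesis using 2 by (simp add: E_def)
    next
      case 3
      have "z \<in> D"
      proof (rule chains_maximal[OF D z])
        fix c assume c: "c \<in> D"
        show "c \<sqsubseteq> z \<or> z \<sqsubseteq> c"
          using comp[of c] chains_total[OF D c a(2)] chains_total[OF D c b(2)] c 3 z carr
            chains_carrier[OF D c] le_trans
          unfolding E_def by blast
      qed
      then show ?thesis using 3 by (simp add: E_def)
    qed
  qed
  have inner: "pf E s = pf D s" if "snd a \<le> s" "s \<le> snd b" for s
    by (rule path_fun_cong[OF D E a(2) b(2) _ that])
       (simp add: E_def chains_level_le[OF D] a b)
  have lower: "pf E s = pf C s" if "snd \<bottom> \<le> s" "s \<le> snd a" for s
    by (rule path_fun_cong[OF C E bottom_in_chain[OF C] a(1) _ that])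
       (simp add: E_def chains_level_le[OF C] a b)
  have upper: "pf E s = pf C s" if "snd b \<le> s" "s \<le> snd \<top>" for s
    by (rule path_fun_cong[OF C E b(1) top_in_chain[OF C] _ that])
       (simp add: E_def chains_level_le[OF C] a b)
  show thesis
  proof (rule that[OF E])
    \<comment> \<open>By the choice of \<open>a\<close> and \<open>b\<close>, no common element is
      strictly between them in height, so \<open>p\<close> is on the part kept from
      \<open>C\<close>.\<close>
    have "snd p \<le> snd a \<or> snd b \<le> snd p"
      using a(4) b(4) p by (meson linear)
    then show "p \<in> E"
      using p a b chains_level_le[OF C] by (auto simp: E_def)
    show "pf E t = pf D t"
      using inner a b by simp
    fix s assume s: "s \<in> levels"
    show "pf E s = pf C s \<or> pf E s = pf D s \<and> (pf C s < pf D s \<longleftrightarrow> pf C t < pf D t)"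
    proof (cases "snd a < s \<and> s < snd b")
      case True
      have no: "\<not> (snd a < snd e \<and> snd e < snd b)" if "e \<in> C" "e \<in> D" for e
        using a(4) b(4) that by (meson linear not_le)
      have at: "snd a < t" "t < snd b"
        using a b ne in_chain_iff[OF C carr(1)] in_chain_iff[OF D carr(1)]
          in_chain_iff[OF C carr(2)] in_chain_iff[OF D carr(2)] by (metis le_less)+
      \<comment> \<open>A change of sides between the levels \<open>s\<close> and \<open>t\<close>
        would force a common element strictly between the heights of \<open>a\<close> and
        \<open>b\<close>.\<close>
      have "\<not> (pf C s < pf D s \<and> pf D t < pf C t)" "\<not> (pf D s \<le> pf C s \<and> pf C t < pf D t)"
      proof -
        show "\<not> (pf C s < pf D s \<and> pf D t < pf C t)"
          using crossing[OF C D s t] no at True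
          by (smt (verit, ccfv_SIG) max_def min_def)
        show "\<not> (pf D s \<le> pf C s \<and> pf C t < pf D t)"
          using crossing[OF C D t s] no at True
          by (smt (verit, ccfv_SIG) max_def min_def)
      qed
      then show ?thesis
        using inner[of s] True ne by auto
    next
      case False
      then show ?thesis using lower[of s] upper[of s] s by auto
    qed
  qed
qed

section \<open>Existence of the extreme chains through an element\<close>

lemma chains_containing:
  assumes "p \<in> carrier L"
  shows "finite {D \<in> chains. p \<in> D}" "{D \<in> chains. p \<in> D} \<noteq> {}"
proof -
  have "{D \<in> chains. p \<in> D} \<subseteq> Pow (carrier L)"
    using chains_subset by blast
  then show "finite {D \<in> chains. p \<in> D}"
    by (rule finite_subset) (simp add: fin)
  obtain D where "D \<in> chains" "p \<in> D"
    using chain_through[OF assms] .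
  then show "{D \<in> chains. p \<in> D} \<noteq> {}"
    by blast
qed

lemma least_chain_iff:
  assumes "S \<subseteq> chains"
  shows "least (chain_order L) C S \<longleftrightarrow> C \<in> S \<and> (\<forall>D\<in>S. \<forall>t\<in>levels. pf C t \<le> pf D t)"
proof -
  have "least (chain_order L) C S
      \<longleftrightarrow> C \<in> S \<and> (\<forall>D\<in>S. \<forall>t\<in>snd ` path L C. pf C t \<le> pf D t)"
    using assms by (simp add: least_def Lower_def chain_order_def del: ball_simps)
  moreover have "snd ` path L D = levels" if "D \<in> S" for D
    using that assms snd_path by blast
  ultimately show ?thesis
    by (simp cong: conj_cong)
qed

lemma greatest_chain_iff:
  assumes "S \<subseteq> chains"
  shows "greatest (chain_order L) C S \<longleftrightarrow> C \<in> S \<and> (\<forall>D\<in>S. \<forall>t\<in>levels. pf D t \<le> pf C t)"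
proof -
  have "greatest (chain_order L) C S
      \<longleftrightarrow> C \<in> S \<and> (\<forall>D\<in>S. \<forall>t\<in>snd ` path L D. pf D t \<le> pf C t)"
    using assms by (simp add: greatest_def Upper_def chain_order_def del: ball_simps)
  moreover have "snd ` path L D = levels" if "D \<in> S" for D
    using that assms snd_path by blast
  ultimately show ?thesis
    by (simp cong: conj_cong)
qed

lemma LM:
  assumes p: "p \<in> carrier L"
  shows "LM L p \<in> chains" "p \<in> LM L p"
    and LM_le: "\<And>D t. \<lbrakk>D \<in> chains; p \<in> D; t \<in> levels\<rbrakk> \<Longrightarrow> pf (LM L p) t \<le> pf D t"
proof -
  let ?S = "{D \<in> chains. p \<in> D}"
  obtain C where C: "C \<in> ?S" "\<And>D. D \<in> ?S \<Longrightarrow> \<forall>t\<in>levels. pf C t \<le> pf D t"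
  proof (rule finite_least_exists[of ?S "\<lambda>C D. \<forall>t\<in>levels. pf C t \<le> pf D t"])
    fix C D assume CD: "C \<in> ?S" "D \<in> ?S" "\<not> (\<forall>t\<in>levels. pf C t \<le> pf D t)"
    then obtain t where t: "t \<in> levels" "pf D t < pf C t" by (auto simp: not_le)
    \<comment> \<open>Since \<open>D\<close> is left of \<open>C\<close> at level \<open>t\<close>,
      splicing it into \<open>C\<close> gives a chain through \<open>p\<close> that is nowhere right
      of \<open>C\<close> and strictly left of it at \<open>t\<close>.\<close>
    obtain E where "E \<in> chains" "p \<in> E" "pf E t = pf D t"
      "\<And>s. s \<in> levels \<Longrightarrow> pf E s = pf C s \<or>
        pf E s = pf D s \<and> (pf C s < pf D s \<longleftrightarrow> pf C t < pf D t)"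
      using chains_splice[of C D p t] CD t by auto
    then show "\<exists>E\<in>?S. (\<forall>t\<in>levels. pf E t \<le> pf C t) \<and> \<not> (\<forall>t\<in>levels. pf C t \<le> pf E t)"
      using t by (intro bexI[of _ E]) (force simp: not_less)+
  qed (use chains_containing[OF p] in \<open>auto intro: order_trans\<close>)
  then have least: "least (chain_order L) C ?S"
    by (subst least_chain_iff) auto
  have "LM L p = C"
    unfolding LM_def
  proof (rule the_equality[of "\<lambda>C. least (chain_order L) C ?S", OF least])
    fix D assume "least (chain_order L) D ?S"
    then have "D \<in> ?S \<and> (\<forall>E\<in>?S. \<forall>t\<in>levels. pf D t \<le> pf E t)"
      by (subst (asm) least_chain_iff) auto
    then show "D = C"
      using C by (intro path_fun_inj) (auto intro: antisym)
  qed
  with C show "LM L p \<in> chains" "p \<in> LM L p"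
    "\<And>D t. \<lbrakk>D \<in> chains; p \<in> D; t \<in> levels\<rbrakk> \<Longrightarrow> pf (LM L p) t \<le> pf D t"
    by auto
qed

lemma RM:
  assumes p: "p \<in> carrier L"
  shows "RM L p \<in> chains" "p \<in> RM L p"
    and RM_ge: "\<And>D t. \<lbrakk>D \<in> chains; p \<in> D; t \<in> levels\<rbrakk> \<Longrightarrow> pf D t \<le> pf (RM L p) t"
proof -
  let ?S = "{D \<in> chains. p \<in> D}"
  obtain C where C: "C \<in> ?S" "\<And>D. D \<in> ?S \<Longrightarrow> \<forall>t\<in>levels. pf D t \<le> pf C t"
  \<comment> \<open>The relation is reversed, so its least element is the rightmost chain.\<close>
  proof (rule finite_least_exists[of ?S "\<lambda>C D. \<forall>t\<in>levels. pf D t \<le> pf C t"])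
    fix C D assume CD: "C \<in> ?S" "D \<in> ?S" "\<not> (\<forall>t\<in>levels. pf D t \<le> pf C t)"
    then obtain t where t: "t \<in> levels" "pf C t < pf D t" by (auto simp: not_le)
    obtain E where "E \<in> chains" "p \<in> E" "pf E t = pf D t"
      "\<And>s. s \<in> levels \<Longrightarrow> pf E s = pf C s \<or>
        pf E s = pf D s \<and> (pf C s < pf D s \<longleftrightarrow> pf C t < pf D t)"
      using chains_splice[of C D p t] CD t by auto
    then show "\<exists>E\<in>?S. (\<forall>t\<in>levels. pf C t \<le> pf E t) \<and> \<not> (\<forall>t\<in>levels. pf E t \<le> pf C t)"
      using t by (intro bexI[of _ E]) (force simp: not_less)+
  qed (use chains_containing[OF p] in \<open>auto intro: order_trans\<close>)
  then have greatest: "greatest (chain_order L) C ?S"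
    by (subst greatest_chain_iff) auto
  have "RM L p = C"
    unfolding RM_def
  proof (rule the_equality[of "\<lambda>C. greatest (chain_order L) C ?S", OF greatest])
    fix D assume "greatest (chain_order L) D ?S"
    then have "D \<in> ?S \<and> (\<forall>E\<in>?S. \<forall>t\<in>levels. pf E t \<le> pf D t)"
      by (subst (asm) greatest_chain_iff) auto
    then show "D = C"
      using C by (intro path_fun_inj) (auto intro: antisym)
  qed
  with C show "RM L p \<in> chains" "p \<in> RM L p"
    "\<And>D t. \<lbrakk>D \<in> chains; p \<in> D; t \<in> levels\<rbrakk> \<Longrightarrow> pf D t \<le> pf (RM L p) t"
    by auto
qed

end

subsection \<open>Rungs between two chains of a lattice\<close>

lemma finite_enumerate_by_key:
  fixes k :: "'a \<Rightarrow> 'b::linorder"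
  assumes "finite P" "inj_on k P"
  obtains g where "bij_betw g {..<card P} P" "\<And>i j. i < j \<Longrightarrow> j < card P \<Longrightarrow> k (g i) < k (g j)"
proof -
  define xs where "xs = sorted_list_of_set (k ` P)"
  have xs: "set xs = k ` P" "length xs = card P" "sorted_wrt (<) xs"
    using assms by (simp_all add: xs_def card_image)
  define g where "g i = inv_into P k (xs ! i)" for i
  have kg: "k (g i) = xs ! i" if "i < card P" for i
    unfolding g_def using that xs by (intro f_inv_into_f) (metis nth_mem)
  have mono: "k (g i) < k (g j)" if "i < j" "j < card P" for i j
    using that xs kg by (simp add: sorted_wrt_nth_less)
  have "inj_on g {..<card P}"
    by (rule inj_onI) (metis lessThan_iff linorder_neqE_nat mono order_less_irrefl)
  moreover have "g ` {..<card P} \<subseteq> P"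
    unfolding g_def using xs by (auto intro!: inv_into_into)
  ultimately have "bij_betw g {..<card P} P"
    using assms(1) by (simp add: bij_betw_def card_image card_subset_eq)
  with mono show thesis by (rule that[rotated])
qed

lemma weak_partial_order_C2_times_C: "weak_partial_order (C2_times_C n)"
  by unfold_locales (auto simp: C2_times_C_def)

lemma image_C2_times_C_subset:
  assumes "\<And>i. i < n \<Longrightarrow> f (0, i) \<in> X \<and> f (1, i) \<in> X"
  shows "f ` carrier (C2_times_C n) \<subseteq> X"
  using assms by (auto simp: C2_times_C_def less_2_cases_iff)

text \<open>The two boundaries without geometry, so that left and right can be exchanged: swapping
  \<open>A\<close> with \<open>B\<close> and \<open>p\<close> with \<open>q\<close> turns one
  direction of rungs into the other. The universal properties of \<open>m\<close> and
  \<open>j\<close> as meet and join are symmetric in \<open>p\<close> and \<open>q\<close>.\<close>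

locale opposite_chains = lattice L for L (structure) +
  fixes A B p q m j
  assumes finA: "finite A" and subA: "A \<subseteq> carrier L" and subB: "B \<subseteq> carrier L"
    and totA: "\<lbrakk>x \<in> A; y \<in> A\<rbrakk> \<Longrightarrow> x \<sqsubseteq> y \<or> y \<sqsubseteq> x"
    and totB: "\<lbrakk>x \<in> B; y \<in> B\<rbrakk> \<Longrightarrow> x \<sqsubseteq> y \<or> y \<sqsubseteq> x"
    and mem: "p \<in> A" "q \<in> B" "m \<in> A" "j \<in> B"
    and incomp: "\<not> p \<sqsubseteq> q" "\<not> q \<sqsubseteq> p"
    and bounds: "m \<sqsubseteq> p" "m \<sqsubseteq> q" "p \<sqsubseteq> j" "q \<sqsubseteq> j"
    and lower: "x \<in> A \<union> B \<Longrightarrow> m \<sqsubseteq> x" and upper: "x \<in> A \<union> B \<Longrightarrow> x \<sqsubseteq> j"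
    and greatest_lower: "\<lbrakk>x \<in> carrier L; x \<sqsubseteq> p; x \<sqsubseteq> q\<rbrakk> \<Longrightarrow> x \<sqsubseteq> m"
    and least_upper: "\<lbrakk>x \<in> carrier L; p \<sqsubseteq> x; q \<sqsubseteq> x\<rbrakk> \<Longrightarrow> j \<sqsubseteq> x"
begin

definition up_rungs :: "('a \<times> 'a) set" where
  "up_rungs = {(x, y). x \<in> A \<and> y \<in> B \<and> covered_by (carrier L) (lless L) x y
     \<and> {x, y} \<inter> {m, j} = {}}"

lemma carr [simp]: "x \<in> A \<Longrightarrow> x \<in> carrier L" "x \<in> B \<Longrightarrow> x \<in> carrier L"
  using subA subB by auto

lemma carr_pqmj [simp]: "p \<in> carrier L" "q \<in> carrier L" "m \<in> carrier L" "j \<in> carrier L"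
  using mem by simp_all

lemma up_rungsD:
  assumes "(x, y) \<in> up_rungs"
  shows "x \<in> A" "y \<in> B" "x \<sqsubseteq> y" "x \<noteq> y" "x \<noteq> m" "x \<noteq> j" "y \<noteq> m" "y \<noteq> j"
    and up_rungs_between: "\<And>z. \<lbrakk>z \<in> carrier L; x \<sqsubseteq> z; z \<sqsubseteq> y\<rbrakk> \<Longrightarrow> z = x \<or> z = y"
  using assms by (auto simp: up_rungs_def covered_by_def lless_eq)

lemma not_below_both: "\<lbrakk>x \<in> A \<union> B; x \<noteq> m; x \<sqsubseteq> p\<rbrakk> \<Longrightarrow> \<not> x \<sqsubseteq> q"
  using greatest_lower[of x] lower[of x] le_antisym[of x m] carr[of x] by auto

lemma not_above_both: "\<lbrakk>x \<in> A \<union> B; x \<noteq> j; p \<sqsubseteq> x\<rbrakk> \<Longrightarrow> \<not> q \<sqsubseteq> x"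
  using least_upper[of x] upper[of x] le_antisym[of x j] carr[of x] by auto

text \<open>If \<open>y\<close> were below \<open>q\<close>, so would be \<open>x\<close>; then
  \<open>x\<close> would not be below \<open>p\<close>, and \<open>p\<close> would be below
  \<open>q\<close> through \<open>x\<close>. So \<open>y\<close> is above \<open>q\<close>, and
  \<open>x\<close> above \<open>p\<close> would make \<open>y\<close> an upper bound of both, hence
  equal to \<open>j\<close>.\<close>

lemma up_rung_position:
  assumes "(x, y) \<in> up_rungs"
  shows "x \<sqsubseteq> p" "x \<noteq> p" "q \<sqsubseteq> y" "q \<noteq> y"
proof -
  note xy = up_rungsD[OF assms]
  have "\<not> y \<sqsubseteq> q"
  proof
    assume "y \<sqsubseteq> q"
    then have xq: "x \<sqsubseteq> q" using xy le_trans by (meson carr carr_pqmj)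
    then have "\<not> x \<sqsubseteq> p" using not_below_both xy by blast
    then have "p \<sqsubseteq> x" using totA xy mem by blast
    with xq incomp show False using le_trans xy by (meson carr carr_pqmj)
  qed
  then show qy: "q \<sqsubseteq> y" "q \<noteq> y"
    using totB[of y q] xy mem by auto
  have "\<not> p \<sqsubseteq> x"
  proof
    assume "p \<sqsubseteq> x"
    then have "p \<sqsubseteq> y" using xy le_trans by (meson carr carr_pqmj)
    with qy show False using not_above_both xy by blast
  qed
  then show "x \<sqsubseteq> p" "x \<noteq> p"
    using totA[of x p] xy mem by auto
qed

text \<open>If \<open>x'\<close> were below \<open>y\<close>, it would be between the ends of the
  first rung and so equal to \<open>y\<close>; but \<open>y\<close> is above \<open>q\<close> and
  \<open>x'\<close> below \<open>p\<close>. Hence \<open>y'\<close>, being above \<open>x'\<close>,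
  is not below \<open>y\<close> either.\<close>

lemma up_rung_lower_mono:
  assumes "(x, y) \<in> up_rungs" "(x', y') \<in> up_rungs" "x \<sqsubseteq> x'" "x \<noteq> x'"
  shows "y \<sqsubseteq> y'" "y \<noteq> y'" "\<not> x' \<sqsubseteq> y"
proof -
  note r = up_rungsD[OF assms(1)] and r' = up_rungsD[OF assms(2)]
  have "x' \<noteq> y"
  proof
    assume "x' = y"
    then have "q \<sqsubseteq> p"
      using up_rung_position[OF assms(1)] up_rung_position[OF assms(2)] le_trans r
      by (meson carr carr_pqmj)
    with incomp show False by blast
  qed
  then show no: "\<not> x' \<sqsubseteq> y"
    using up_rungs_between[OF assms(1), of x'] assms r' by auto
  then have "\<not> y' \<sqsubseteq> y"
    using r r' le_trans by (meson carr)
  then show "y \<sqsubseteq> y'" "y \<noteq> y'"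
    using totB[of y y'] r r' by auto
qed

lemma up_rung_unique:
  assumes "(x, y) \<in> up_rungs" "(x, y') \<in> up_rungs"
  shows "y = y'"
proof -
  note r = up_rungsD[OF assms(1)] and r' = up_rungsD[OF assms(2)]
  show ?thesis
    using totB[OF r(2) r'(2)] up_rungs_between[OF assms(1), of y'] up_rungs_between[OF assms(2), of y]
      r r' by auto
qed

text \<open>The join of the lower ends of two rungs of opposite directions lies between the ends of the
  first rung, but it can be neither of them.\<close>

lemma up_rungs_one_direction:
  assumes "(x, y) \<in> up_rungs"
    and y': "y' \<in> B" "y' \<sqsubseteq> q" "y' \<noteq> m" and x': "x' \<in> A" "p \<sqsubseteq> x'" "x' \<noteq> j" and "y' \<sqsubseteq> x'"
  shows False
proof -
  note r = up_rungsD[OF assms(1)] up_rung_position[OF assms(1)]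
  have "x \<squnion> y' \<sqsubseteq> y"
    using r y' le_trans[of y' q y] by (intro join_le) auto
  moreover have "x \<squnion> y' \<sqsubseteq> x'"
    using r x' assms(8) le_trans[of x p x'] by (intro join_le) (use y' in auto)
  moreover have "x \<sqsubseteq> x \<squnion> y'" "y' \<sqsubseteq> x \<squnion> y'" "x \<squnion> y' \<in> carrier L"
    using r y' by (auto intro: join_left join_right)
  ultimately have "y' \<sqsubseteq> x \<or> y \<sqsubseteq> x'"
    using up_rungs_between[OF assms(1), of "x \<squnion> y'"] by auto
  then show False
  proof
    assume "y' \<sqsubseteq> x"
    then have "y' \<sqsubseteq> p"
      using r y' le_trans[of y' x p] by auto
    then show False using not_below_both y' by blast
  next
    assume "y \<sqsubseteq> x'"
    then have "q \<sqsubseteq> x'"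
      using r x' le_trans[of q y x'] by auto
    then show False using not_above_both x' by blast
  qed
qed

lemma ladder_embedding:
  obtains n f where "n \<ge> 2" "order_emb (C2_times_C n) L f"
    "\<And>i. i < n \<Longrightarrow> f (0, i) \<in> A \<and> f (1, i) \<in> B"
    "up_rungs = {(f (0, i), f (1, i)) | i. 0 < i \<and> i + 1 < n}"
proof -
  \<comment> \<open>The position of the lower end within the chain \<open>A\<close>. It sorts the
    rungs by natural numbers and tells them apart, because the lower end determines the
    rung.\<close>
  define key where "key r = card {z \<in> A. z \<sqsubseteq> fst r}" for r :: "'a \<times> 'a"
  have key_less: "key (x, y) < key (x', y')"
    if "x \<in> A" "x' \<in> A" "x \<sqsubseteq> x'" "x \<noteq> x'" for x y x' y'
  proof -
    have "{z \<in> A. z \<sqsubseteq> x} \<subseteq> {z \<in> A. z \<sqsubseteq> x'}" "x' \<notin> {z \<in> A. z \<sqsubseteq> x}" "x' \<in> {z \<in> A. z \<sqsubseteq> x'}"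
      using that le_trans[of _ x x'] le_antisym[of x x'] by auto
    then show ?thesis
      unfolding key_def using finA by (intro psubset_card_mono) auto
  qed
  have key_iff: "key (x, y) < key (x', y') \<longleftrightarrow> x \<sqsubseteq> x' \<and> x \<noteq> x'"
    if "x \<in> A" "x' \<in> A" for x y x' y'
    using key_less[of x x' y y'] key_less[of x' x y' y] totA[of x x'] that
    by (metis fst_conv key_def less_asym less_irrefl)
  have fin: "finite up_rungs"
  proof (rule inj_on_finite[of fst _ A])
    show "inj_on fst up_rungs"
      using up_rung_unique by (auto simp: inj_on_def)
    show "fst ` up_rungs \<subseteq> A"
      using up_rungsD by auto
  qed (rule finA)
  have inj: "inj_on key up_rungs"
  proof (rule inj_onI)
    fix r s assume rs: "r \<in> up_rungs" "s \<in> up_rungs" "key r = key s"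
    obtain x y x' y' where eqs: "r = (x, y)" "s = (x', y')"
      by (metis surj_pair)
    have "x \<in> A" "x' \<in> A"
      using rs eqs up_rungsD by auto
    then have "x = x'"
      using key_iff[of x x' y y'] key_iff[of x' x y' y] totA[of x x'] rs eqs by auto
    then show "r = s"
      using up_rung_unique rs eqs by blast
  qed
  obtain g where g: "bij_betw g {..<card up_rungs} up_rungs"
    "\<And>i k. i < k \<Longrightarrow> k < card up_rungs \<Longrightarrow> key (g i) < key (g k)"
    using finite_enumerate_by_key[OF fin inj] by blast
  define N where "N = card up_rungs"
  \<comment> \<open>The rungs, counted from 1, are \<open>g (i - 1)\<close>. Index 0 is the pair
    \<open>m\<close>, \<open>q\<close> and index \<open>N + 1\<close> the pair \<open>p\<close>,
    \<open>j\<close>; they frame the rungs but are none, as they contain \<open>m\<close> or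
    \<open>j\<close>. Hence \<open>n = N + 2\<close>.\<close>
  define lo where "lo i = (if i = 0 then m else if i \<le> N then fst (g (i - 1)) else p)" for i
  define hi where "hi i = (if i = 0 then q else if i \<le> N then snd (g (i - 1)) else j)" for i
  have rung: "(lo i, hi i) \<in> up_rungs" if "0 < i" "i \<le> N" for i
    using that g(1) by (auto simp: lo_def hi_def N_def bij_betw_def)
  have rungs: "up_rungs = {(lo i, hi i) | i. 0 < i \<and> i \<le> N}"
  proof (intro equalityI subsetI)
    fix r assume "r \<in> up_rungs"
    then obtain i where "i < N" "r = g i"
      using g(1) by (auto simp: bij_betw_def N_def)
    then have "r = (lo (Suc i), hi (Suc i))" "Suc i \<le> N"
      by (auto simp: lo_def hi_def)
    then show "r \<in> {(lo i, hi i) | i. 0 < i \<and> i \<le> N}"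
      by blast
  qed (use rung in blast)
  have lo0: "lo 0 = m" and hi0: "hi 0 = q" and loN: "lo (Suc N) = p" and hiN: "hi (Suc N) = j"
    by (auto simp: lo_def hi_def)
  have cases: "i = 0 \<or> 0 < i \<and> i \<le> N \<or> i = Suc N" if "i < N + 2" for i
    using that by auto
  have memb: "lo i \<in> A" "hi i \<in> B" "lo i \<sqsubseteq> p" "q \<sqsubseteq> hi i" "lo i \<sqsubseteq> hi i" if "i < N + 2" for i
    using cases[OF that] rung[of i] up_rungsD[of "lo i" "hi i"] up_rung_position[of "lo i" "hi i"]
      mem bounds by (auto simp: lo0 hi0 loN hiN)
  \<comment> \<open>The last conjunct excludes comparabilities across the sides that the product
    order does not have; those leading from \<open>hi\<close> to \<open>lo\<close> are excluded
    next.\<close>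
  have less: "lo i \<sqsubseteq> lo k \<and> lo i \<noteq> lo k \<and> hi i \<sqsubseteq> hi k \<and> hi i \<noteq> hi k \<and> \<not> lo k \<sqsubseteq> hi i"
    if ik: "i < k" "k < N + 2" for i k
  proof -
    consider "i = 0" "0 < k" "k \<le> N" | "i = 0" "k = Suc N" | "0 < i" "i \<le> N" "k = Suc N"
      | "0 < i" "i \<le> N" "0 < k" "k \<le> N"
      using ik by linarith
    then show ?thesis
    proof cases
      case 1
      note r = up_rungsD[OF rung[OF 1(2,3)]] up_rung_position[OF rung[OF 1(2,3)]]
      show ?thesis
        using r lower not_below_both[of "lo k"] 1 by (auto simp: lo0 hi0)
    next
      case 2
      then show ?thesis
        using bounds incomp by (auto simp: lo0 hi0 loN hiN)
    next
      case 3
      note r = up_rungsD[OF rung[OF 3(1,2)]] up_rung_position[OF rung[OF 3(1,2)]]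
      show ?thesis
        using r upper not_above_both[of "hi i"] 3 by (auto simp: loN hiN)
    next
      case 4
      have "g (i - 1) = (lo i, hi i)" "g (k - 1) = (lo k, hi k)"
        using 4 by (auto simp: lo_def hi_def)
      then have "key (lo i, hi i) < key (lo k, hi k)"
        using g(2)[of "i - 1" "k - 1"] 4 ik by (simp add: N_def)
      then have "lo i \<sqsubseteq> lo k \<and> lo i \<noteq> lo k"
        using key_iff memb ik by simp
      then show ?thesis
        using up_rung_lower_mono[OF rung[OF 4(1,2)] rung[OF 4(3,4)]] by blast
    qed
  qed
  have not_hi_lo: "\<not> hi i \<sqsubseteq> lo k" if "i < N + 2" "k < N + 2" for i k
  proof
    assume "hi i \<sqsubseteq> lo k"
    then have "q \<sqsubseteq> lo k"
      using memb[OF that(1)] memb[OF that(2)] le_trans[of q "hi i" "lo k"] by auto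
    then show False
      using memb[OF that(2)] le_trans[of q "lo k" p] incomp by auto
  qed
  have lo_iff: "lo i \<sqsubseteq> lo k \<longleftrightarrow> i \<le> k" and hi_iff: "hi i \<sqsubseteq> hi k \<longleftrightarrow> i \<le> k"
    and lo_hi_iff: "lo i \<sqsubseteq> hi k \<longleftrightarrow> i \<le> k" if "i < N + 2" "k < N + 2" for i k
  proof -
    note M = memb[OF that(1)] memb[OF that(2)]
    consider "i < k" | "i = k" | "k < i" by linarith
    note c = this
    show "lo i \<sqsubseteq> lo k \<longleftrightarrow> i \<le> k"
      using c less[of i k] less[of k i] that M le_antisym[of "lo i" "lo k"] by cases auto
    show "hi i \<sqsubseteq> hi k \<longleftrightarrow> i \<le> k"
      using c less[of i k] less[of k i] that M le_antisym[of "hi i" "hi k"] by cases auto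
    show "lo i \<sqsubseteq> hi k \<longleftrightarrow> i \<le> k"
      using c less[of i k] less[of k i] that M le_trans[of "lo i" "lo k" "hi k"] by cases auto
  qed
  define f where "f = (\<lambda>(a :: nat, i). if a = 0 then lo i else hi i)"
  show thesis
  proof (rule that[of "N + 2" f])
    have "f u \<sqsubseteq> f v \<longleftrightarrow> fst u \<le> fst v \<and> snd u \<le> snd v"
      if "u \<in> {..<2} \<times> {..<N + 2}" "v \<in> {..<2} \<times> {..<N + 2}" for u v
    proof -
      obtain a i b k where uv: "u = (a, i)" "v = (b, k)"
        by (metis surj_pair)
      have "a = 0 \<or> a = 1" "b = 0 \<or> b = 1" "i < N + 2" "k < N + 2"
        using that uv by auto
      then show ?thesis
        using lo_iff[of i k] hi_iff[of i k] lo_hi_iff[of i k] not_hi_lo[of i k] uv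
        by (auto simp: f_def)
    qed
    then show "order_emb (C2_times_C (N + 2)) L f"
      unfolding order_emb_def
      using weak_partial_order_C2_times_C weak_partial_order_axioms
      by (simp add: C2_times_C_def)
    show "f (0, i) \<in> A \<and> f (1, i) \<in> B" if "i < N + 2" for i
      using memb[OF that] by (simp add: f_def)
    show "up_rungs = {(f (0, i), f (1, i)) | i. 0 < i \<and> i + 1 < N + 2}"
      using rungs by (simp add: f_def less_Suc_eq_le)
  qed simp
qed

end

subsection \<open>Local regions\<close>

context planar_lattice
begin

text \<open>A maximal chain through \<open>z\<close> is between \<open>C\<close> and
  \<open>D\<close> at the level of \<open>z\<close>, while these two are pinched together at
  \<open>e\<close>. On the way it meets \<open>C\<close> or \<open>D\<close> in an element, which is
  comparable with \<open>z\<close> along the new chain and with \<open>e\<close> along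
  \<open>C\<close> or \<open>D\<close>.\<close>

lemma squeeze:
  assumes C: "C \<in> chains" and D: "D \<in> chains" and e: "e \<in> C" "e \<in> D" and z: "z \<in> carrier L"
    and between: "pf C (snd z) \<le> fst z" "fst z \<le> pf D (snd z)"
  shows "snd e \<le> snd z \<Longrightarrow> e \<sqsubseteq> z" "snd z \<le> snd e \<Longrightarrow> z \<sqsubseteq> e"
proof -
  obtain E where E: "E \<in> chains" "z \<in> E"
    using chain_through z by blast
  have eL: "e \<in> carrier L"
    using C e chains_carrier by blast
  have pe: "pf C (snd e) = fst e" "pf D (snd e) = fst e" "pf E (snd z) = fst z"
    using in_chain_iff C D E e z eL by blast+
  note lev = level_in_levels[OF z] level_in_levels[OF eL]
  obtain x where x: "x \<in> E" "x \<in> C \<or> x \<in> D"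
    "min (snd e) (snd z) \<le> snd x" "snd x \<le> max (snd e) (snd z)"
  proof -
    consider "pf E (snd e) = fst e" | "pf E (snd e) < fst e" | "fst e < pf E (snd e)"
      by linarith
    then show thesis
    proof cases
      case 1
      then have "e \<in> E"
        using in_chain_iff E(1) eL by blast
      then show thesis
        by (rule that) (use e in auto)
    next
      case 2
      \<comment> \<open>\<open>E\<close> passes left of \<open>e\<close> but is not left of
        \<open>C\<close> at the level of \<open>z\<close>, so it crosses \<open>C\<close>. The next
        case is the mirror image with \<open>D\<close>.\<close>
      show thesis
        by (rule crossing[OF E(1) C lev(2,1)]) (use 2 pe between that in auto)
    next
      case 3
      show thesis
        by (rule crossing[OF D E(1) lev(2,1)]) (use 3 pe between that in auto)
    qed
  qed
  then have xL: "x \<in> carrier L"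
    using E chains_carrier by blast
  show "e \<sqsubseteq> z" if "snd e \<le> snd z"
  proof -
    have "e \<sqsubseteq> x"
      using x that chains_level_le[OF C e(1), of x] chains_level_le[OF D e(2), of x] by auto
    moreover have "x \<sqsubseteq> z"
      using x that chains_level_le[OF E(1) x(1) E(2)] by auto
    ultimately show ?thesis
      using le_trans eL xL z by blast
  qed
  show "z \<sqsubseteq> e" if "snd z \<le> snd e"
  proof -
    have "x \<sqsubseteq> e"
      using x that chains_level_le[OF C _ e(1), of x] chains_level_le[OF D _ e(2), of x] by auto
    moreover have "z \<sqsubseteq> x"
      using x that chains_level_le[OF E(1) E(2) x(1)] by auto
    ultimately show ?thesis
      using le_trans eL xL z by blast
  qed
qed

lemma squeeze_comparable:
  assumes "C \<in> chains" "D \<in> chains" "e \<in> C" "e \<in> D" "z \<in> carrier L"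
    "pf C (snd z) \<le> fst z" "fst z \<le> pf D (snd z)"
  shows "e \<sqsubseteq> z \<or> z \<sqsubseteq> e"
  using squeeze[OF assms] linear[of "snd e" "snd z"] by blast

text \<open>The element \<open>e\<close> links \<open>p\<close> and \<open>z\<close>: along
  \<open>D\<close> from \<open>p\<close> to \<open>e\<close>, by squeezing from \<open>e\<close> to
  \<open>z\<close>. Its height between theirs makes both steps go in the same direction.\<close>

lemma squeeze_between:
  assumes C: "C \<in> chains" and D: "D \<in> chains" and e: "e \<in> C" "e \<in> D"
    and p: "p \<in> D" and z: "z \<in> carrier L"
    and ends: "min (snd p) (snd z) \<le> snd e" "snd e \<le> max (snd p) (snd z)"
    and between: "pf C (snd z) \<le> fst z \<and> fst z \<le> pf D (snd z)
      \<or> pf D (snd z) \<le> fst z \<and> fst z \<le> pf C (snd z)"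
  shows "p \<sqsubseteq> z \<or> z \<sqsubseteq> p"
proof -
  have carr: "e \<in> carrier L" "p \<in> carrier L"
    using D e p chains_carrier by blast+
  have sq: "snd e \<le> snd z \<Longrightarrow> e \<sqsubseteq> z" "snd z \<le> snd e \<Longrightarrow> z \<sqsubseteq> e"
    using between squeeze[OF C D e z] squeeze[OF D C e(2,1) z] by blast+
  show ?thesis
  proof (cases "snd p \<le> snd z")
    case True
    then have "p \<sqsubseteq> e" "e \<sqsubseteq> z"
      using ends sq chains_level_le[OF D p e(2)] by auto
    then show ?thesis using le_trans carr z by blast
  next
    case False
    then have "e \<sqsubseteq> p" "z \<sqsubseteq> e"
      using ends sq chains_level_le[OF D e(2) p] by auto
    then show ?thesis using le_trans carr z by blast
  qed
qed

text \<open>\<open>D\<close> is not right of \<open>C\<close> at the level of \<open>p\<close> and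
  not left of it at the level of \<open>z\<close>, so they share an element in between that links
  \<open>p\<close> and \<open>z\<close>. With \<open>D\<close> chosen as \<open>RM(p)\<close>, this
  lets \<open>RM(p)\<close> replace any chain separating \<open>p\<close> from an incomparable
  \<open>z\<close> to its right.\<close>

lemma comparable_right:
  assumes C: "C \<in> chains" and D: "D \<in> chains" and p: "p \<in> D" and z: "z \<in> carrier L"
    and "fst p \<le> pf C (snd p)" "pf C (snd z) \<le> fst z" "fst z \<le> pf D (snd z)"
  shows "p \<sqsubseteq> z \<or> z \<sqsubseteq> p"
proof -
  have pL: "p \<in> carrier L"
    using D p chains_carrier by blast
  have Dp: "pf D (snd p) = fst p"
    using in_chain_iff D p pL by blast
  show ?thesis
  proof (cases "pf C (snd p) = fst p")
    case True
    then have "p \<in> C" using in_chain_iff C pL by blast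
    then show ?thesis
      using squeeze_comparable[OF C D _ p z] assms by blast
  next
    case False
    then have "pf D (snd p) < pf C (snd p)" "pf C (snd z) \<le> pf D (snd z)"
      using Dp assms by auto
    then obtain e where "e \<in> D" "e \<in> C"
      "min (snd p) (snd z) \<le> snd e" "snd e \<le> max (snd p) (snd z)"
      using crossing[OF D C level_in_levels[OF pL] level_in_levels[OF z]] by blast
    then show ?thesis
      using squeeze_between[OF C D _ _ p z] assms by blast
  qed
qed

lemma comparable_left:
  assumes C: "C \<in> chains" and D: "D \<in> chains" and p: "p \<in> D" and z: "z \<in> carrier L"
    and "pf C (snd p) \<le> fst p" "fst z \<le> pf C (snd z)" "pf D (snd z) \<le> fst z"
  shows "p \<sqsubseteq> z \<or> z \<sqsubseteq> p"
proof -
  have pL: "p \<in> carrier L"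
    using D p chains_carrier by blast
  have Dp: "pf D (snd p) = fst p"
    using in_chain_iff D p pL by blast
  show ?thesis
  proof (cases "pf C (snd p) = fst p")
    case True
    then have "p \<in> C" using in_chain_iff C pL by blast
    then show ?thesis
      using squeeze_comparable[OF D C p _ z] assms by blast
  next
    case False
    then have "pf C (snd p) < pf D (snd p)" "pf D (snd z) \<le> pf C (snd z)"
      using Dp assms by auto
    then obtain e where "e \<in> C" "e \<in> D"
      "min (snd p) (snd z) \<le> snd e" "snd e \<le> max (snd p) (snd z)"
      using crossing[OF C D level_in_levels[OF pL] level_in_levels[OF z]] by blast
    then show ?thesis
      using squeeze_between[OF C D _ _ p z] assms by blast
  qed
qed

section \<open>The left-to-right order in terms of extreme chains\<close>

lemma lr_less_iff_RM:
  assumes pL: "p \<in> carrier L" and zL: "z \<in> carrier L"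
  shows "lr_less L p z \<longleftrightarrow> incomparable L p z \<and> pf (RM L p) (snd z) < fst z"
proof
  assume "lr_less L p z"
  then obtain C where inc: "incomparable L p z" and C: "C \<in> chains"
    "fst p \<le> pf C (snd p)" "pf C (snd z) \<le> fst z"
    by (auto simp: lr_less_def point_le_chain_def chain_le_point_def)
  \<comment> \<open>If \<open>RM(p)\<close> were not left of \<open>z\<close>, then \<open>z\<close>
    would be between \<open>C\<close> and \<open>RM(p)\<close>, hence comparable with
    \<open>p\<close>.\<close>
  then show "incomparable L p z \<and> pf (RM L p) (snd z) < fst z"
    using comparable_right[OF C(1) RM(1,2)[OF pL] zL C(2,3)] by (auto simp: incomparable_def not_less)
next
  have "pf (RM L p) (snd p) = fst p"
    using in_chain_iff RM[OF pL] pL by blast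
  then show "lr_less L p z" if "incomparable L p z \<and> pf (RM L p) (snd z) < fst z"
    using that pL zL RM(1)[OF pL]
    by (auto simp: lr_less_def point_le_chain_def chain_le_point_def intro!: bexI[of _ "RM L p"])
qed

lemma lr_less_iff_LM:
  assumes pL: "p \<in> carrier L" and zL: "z \<in> carrier L"
  shows "lr_less L p z \<longleftrightarrow> incomparable L p z \<and> fst p < pf (LM L z) (snd p)"
proof
  assume "lr_less L p z"
  then obtain C where inc: "incomparable L p z" and C: "C \<in> chains"
    "fst p \<le> pf C (snd p)" "pf C (snd z) \<le> fst z"
    by (auto simp: lr_less_def point_le_chain_def chain_le_point_def)
  then show "incomparable L p z \<and> fst p < pf (LM L z) (snd p)"
    using comparable_left[OF C(1) LM(1,2)[OF zL] pL C(3,2)] by (auto simp: incomparable_def not_less)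
next
  have "pf (LM L z) (snd z) = fst z"
    using in_chain_iff LM[OF zL] zL by blast
  then show "lr_less L p z" if "incomparable L p z \<and> fst p < pf (LM L z) (snd p)"
    using that pL zL LM(1)[OF zL]
    by (auto simp: lr_less_def point_le_chain_def chain_le_point_def intro!: bexI[of _ "LM L z"])
qed

end

section \<open>How \<open>RM(p)\<close> and \<open>LM(q)\<close> enclose the local region\<close>

locale local_region = planar_lattice +
  fixes p q :: point
  assumes lr: "lr_less L p q"
begin

abbreviation R where "R \<equiv> RM L p"
abbreviation S where "S \<equiv> LM L q"
abbreviation m where "m \<equiv> p \<sqinter> q"
abbreviation j where "j \<equiv> p \<squnion> q"

lemma pq [simp]: "p \<in> carrier L" "q \<in> carrier L"
  using lr by (auto simp: lr_less_def)

lemma mj_carrier: "m \<in> carrier L" "j \<in> carrier L"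
  by simp_all

lemma incomp: "\<not> p \<sqsubseteq> q" "\<not> q \<sqsubseteq> p"
  using lr by (auto simp: lr_less_def incomparable_def)

lemma distinct: "p \<noteq> q" "q \<noteq> p"
  using incomp(1) le_refl[OF pq(1)] by auto

lemma bounds: "m \<sqsubseteq> p" "m \<sqsubseteq> q" "p \<sqsubseteq> j" "q \<sqsubseteq> j"
  by (simp_all add: meet_left meet_right join_left join_right)

lemma RS: "R \<in> chains" "S \<in> chains" "p \<in> R" "q \<in> S"
  by (simp_all add: RM LM)

lemma level_less: "snd m < snd p" "snd m < snd q" "snd p < snd j" "snd q < snd j"
proof -
  have "m \<noteq> p" "m \<noteq> q" "j \<noteq> p" "j \<noteq> q"
    using bounds incomp by auto
  then show "snd m < snd p" "snd m < snd q" "snd p < snd j" "snd q < snd j"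
    using less_level bounds pq mj_carrier by metis+
qed

lemma sides: "pf R (snd q) < fst q" "fst p < pf S (snd p)" "pf R (snd p) = fst p" "pf S (snd q) = fst q"
  using lr lr_less_iff_RM lr_less_iff_LM in_chain_iff RS pq by blast+

text \<open>Such an \<open>x\<close> is comparable with \<open>p\<close> and with \<open>q\<close>,
  and it cannot be above one and below the other. The names \<open>p'\<close> and \<open>q'\<close>
  stand for \<open>p\<close> and \<open>q\<close> in either order, to serve both
  \<open>RM(p)\<close> and \<open>LM(q)\<close>.\<close>

lemma common_bound:
  assumes C: "C \<in> chains" "p' \<in> C" "x \<in> C" and D: "D \<in> chains" "q' \<in> D" "x \<in> D" and "p' \<in> {p, q}" "q' \<in> {p, q}" "p' \<noteq> q'"
  shows "j \<sqsubseteq> x \<or> x \<sqsubseteq> m"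
proof -
  have "x \<in> carrier L"
    using C chains_carrier by blast
  moreover have "x \<sqsubseteq> p' \<or> p' \<sqsubseteq> x" "x \<sqsubseteq> q' \<or> q' \<sqsubseteq> x"
    using chains_total C D by blast+
  moreover have "\<not> p' \<sqsubseteq> q'" "\<not> q' \<sqsubseteq> p'" "p' \<in> carrier L" "q' \<in> carrier L"
    using assms(7-9) incomp pq by blast+
  ultimately have "p' \<sqsubseteq> x \<and> q' \<sqsubseteq> x \<or> x \<sqsubseteq> p' \<and> x \<sqsubseteq> q'"
    using le_trans by blast
  then have "p \<sqsubseteq> x \<and> q \<sqsubseteq> x \<or> x \<sqsubseteq> p \<and> x \<sqsubseteq> q"
    using assms(7-9) by blast
  then show ?thesis
    using join_le[of p x q] meet_le[of x p q] \<open>x \<in> carrier L\<close> by auto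
qed

text \<open>By \<open>common_bound\<close> a common element \<open>e\<close> is not strictly between
  \<open>m\<close> and \<open>j\<close> in height. Being between the heights of \<open>q'\<close>
  and \<open>x\<close>, it is at the height of \<open>x\<close>, hence equal to \<open>x\<close> on
  the chain \<open>D\<close>.\<close>

lemma common_end:
  assumes C: "C \<in> chains" "p' \<in> C" and D: "D \<in> chains" "q' \<in> D" "x \<in> D" and "p' \<in> {p, q}" "q' \<in> {p, q}" "p' \<noteq> q'"
    and x: "x \<in> {m, j}" and e: "e \<in> C" "e \<in> D" "min (snd q') (snd x) \<le> snd e" "snd e \<le> max (snd q') (snd x)"
  shows "x \<in> C"
proof -
  have eL: "e \<in> carrier L"
    using C e chains_carrier by blast
  have "j \<sqsubseteq> e \<or> e \<sqsubseteq> m"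
    by (rule common_bound[OF C e(1) D(1,2) e(2)]) fact+
  then have "snd j \<le> snd e \<or> snd e \<le> snd m"
    using le_level eL mj_carrier by blast
  moreover have "snd m < snd q'" "snd q' < snd j"
    using assms(7) level_less by auto
  ultimately have "snd e = snd x"
    using x e(3,4) by auto
  then show ?thesis
    using chains_level_inj D e by blast
qed

text \<open>\<open>RM(p)\<close> is not left of \<open>x\<close>, since some chain joins
  \<open>p\<close> and \<open>x\<close>, but it is left of \<open>q\<close>. So it crosses a chain
  joining \<open>q\<close> and \<open>x\<close>, and by \<open>common_end\<close> only
  \<open>x\<close> can be the crossing.\<close>

lemma mj_in_R: "x \<in> {m, j} \<Longrightarrow> x \<in> R"
proof -
  assume x: "x \<in> {m, j}"
  then have comp: "p \<sqsubseteq> x \<or> x \<sqsubseteq> p" "q \<sqsubseteq> x \<or> x \<sqsubseteq> q" and xL: "x \<in> carrier L"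
    using bounds mj_carrier by blast+
  obtain D where D: "D \<in> chains" "p \<in> D" "x \<in> D"
    using comp(1) chain_through2 xL pq by metis
  obtain E where E: "E \<in> chains" "q \<in> E" "x \<in> E"
    using comp(2) chain_through2 xL pq by metis
  have "pf D (snd x) = fst x" "pf E (snd x) = fst x" "pf E (snd q) = fst q"
    using D E in_chain_iff xL pq by blast+
  then have "pf E (snd x) \<le> pf R (snd x)" "pf R (snd q) < pf E (snd q)"
    using RM_ge[of p D "snd x"] D sides level_in_levels[OF xL] by auto
  then obtain e where e: "e \<in> R" "e \<in> E" "min (snd q) (snd x) \<le> snd e" "snd e \<le> max (snd q) (snd x)"
    using crossing[OF RS(1) E(1) level_in_levels[OF pq(2)] level_in_levels[OF xL]] by blast
  then show "x \<in> R"
    by (intro common_end[OF RS(1,3) E _ _ distinct(1) x e(1,2,3,4)]) simp_all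
qed

lemma mj_in_S: "x \<in> {m, j} \<Longrightarrow> x \<in> S"
proof -
  assume x: "x \<in> {m, j}"
  then have comp: "p \<sqsubseteq> x \<or> x \<sqsubseteq> p" "q \<sqsubseteq> x \<or> x \<sqsubseteq> q" and xL: "x \<in> carrier L"
    using bounds mj_carrier by blast+
  obtain D where D: "D \<in> chains" "p \<in> D" "x \<in> D"
    using comp(1) chain_through2 xL pq by metis
  obtain E where E: "E \<in> chains" "q \<in> E" "x \<in> E"
    using comp(2) chain_through2 xL pq by metis
  have "pf D (snd x) = fst x" "pf E (snd x) = fst x" "pf D (snd p) = fst p"
    using D E in_chain_iff xL pq by blast+
  then have "pf S (snd x) \<le> pf D (snd x)" "pf D (snd p) < pf S (snd p)"
    using LM_le[of q E "snd x"] E sides level_in_levels[OF xL] by auto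
  then obtain e where e: "e \<in> D" "e \<in> S" "min (snd p) (snd x) \<le> snd e" "snd e \<le> max (snd p) (snd x)"
    using crossing[OF D(1) RS(2) level_in_levels[OF pq(1)] level_in_levels[OF xL]] by blast
  then show "x \<in> S"
    by (intro common_end[OF RS(2,4) D _ _ distinct(2) x e(2,1,3,4)]) simp_all
qed

text \<open>The order is right at the level of \<open>p\<close>. A change of sides on the way to
  \<open>t\<close> would create a common element strictly between \<open>m\<close> and
  \<open>j\<close> in height.\<close>

lemma R_less_S:
  assumes "snd m < t" "t < snd j"
  shows "pf R t < pf S t"
proof (rule ccontr)
  assume "\<not> pf R t < pf S t"
  moreover have "t \<in> levels"
    using assms level_in_levels[of m] level_in_levels[of j] by simp
  ultimately obtain e where e: "e \<in> R" "e \<in> S" "min (snd p) t \<le> snd e" "snd e \<le> max (snd p) t"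
    using crossing[OF RS(1,2) level_in_levels[OF pq(1)], of t] sides by (auto simp: not_less)
  have eL: "e \<in> carrier L"
    using e RS chains_carrier by blast
  have "j \<sqsubseteq> e \<or> e \<sqsubseteq> m"
    by (rule common_bound[OF RS(1,3) e(1) RS(2,4) e(2)]) (simp_all add: distinct)
  then have "snd j \<le> snd e \<or> snd e \<le> snd m"
    using le_level eL mj_carrier by blast
  then show False
    using e(3,4) assms level_less by auto
qed

lemma R_le_S:
  assumes "snd m \<le> t" "t \<le> snd j"
  shows "pf R t \<le> pf S t"
proof -
  have "pf R (snd x) = pf S (snd x)" if "x \<in> {m, j}" for x
    using mj_in_R[OF that] mj_in_S[OF that] in_chain_iff[OF RS(1), of x] in_chain_iff[OF RS(2), of x]
      that mj_carrier by auto
  from this[of m] this[of j] show ?thesis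
    using R_less_S[of t] assms by (cases "t = snd m \<or> t = snd j") auto
qed

section \<open>Boundaries and interior of the local region\<close>

lemma LocReg_iff:
  "z \<in> LocReg L p q \<longleftrightarrow> z \<in> carrier L \<and> m \<sqsubseteq> z \<and> z \<sqsubseteq> j
     \<and> pf R (snd z) \<le> fst z \<and> fst z \<le> pf S (snd z)"
  by (auto simp: LocReg_def at_least_at_most_def chain_le_point_def point_le_chain_def)

text \<open>Between \<open>m\<close> and \<open>j\<close> the chain \<open>RM(p)\<close> is nowhere
  right of \<open>LM(q)\<close>, so its elements there satisfy both side conditions of the
  region.\<close>

lemma left_boundary_iff: "z \<in> left_boundary L p q \<longleftrightarrow> z \<in> R \<and> m \<sqsubseteq> z \<and> z \<sqsubseteq> j"
  using LocReg_iff[of z] in_chain_iff[OF RS(1), of z] chains_carrier[OF RS(1), of z]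
    R_le_S[of "snd z"] le_level[of m z] le_level[of z j] mj_carrier
  by (auto simp: left_boundary_def)

lemma right_boundary_iff: "z \<in> right_boundary L p q \<longleftrightarrow> z \<in> S \<and> m \<sqsubseteq> z \<and> z \<sqsubseteq> j"
  using LocReg_iff[of z] in_chain_iff[OF RS(2), of z] chains_carrier[OF RS(2), of z]
    R_le_S[of "snd z"] le_level[of m z] le_level[of z j] mj_carrier
  by (auto simp: right_boundary_def)

lemma LocInt_iff_lr_between:
  "z \<in> LocInt L p q \<longleftrightarrow> z \<in> carrier L \<and> lr_less L p z \<and> lr_less L z q"
proof
  assume "z \<in> LocInt L p q"
  then have zL: "z \<in> carrier L" and int: "pf R (snd z) < fst z" "fst z < pf S (snd z)"
    by (auto simp: LocInt_def LocReg_iff chain_less_point_def point_less_chain_def)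
  have "incomparable L p z"
  proof (rule ccontr)
    assume "\<not> incomparable L p z"
    \<comment> \<open>A chain through \<open>p\<close> and \<open>z\<close> is nowhere right of
      \<open>RM(p)\<close>, whereas \<open>z\<close> is.\<close>
    then obtain D where "D \<in> chains" "p \<in> D" "z \<in> D"
      using chain_through2 zL pq unfolding incomparable_def by metis
    then show False
      using RM_ge[of p D "snd z"] in_chain_iff[of D z] zL int level_in_levels[OF zL] by auto
  qed
  moreover have "incomparable L z q"
  proof (rule ccontr)
    assume "\<not> incomparable L z q"
    then obtain D where "D \<in> chains" "q \<in> D" "z \<in> D"
      using chain_through2 zL pq unfolding incomparable_def by metis
    then show False
      using LM_le[of q D "snd z"] in_chain_iff[of D z] zL int level_in_levels[OF zL] by auto
  qed
  ultimately show "z \<in> carrier L \<and> lr_less L p z \<and> lr_less L z q"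
    using int zL lr_less_iff_RM[of p z] lr_less_iff_LM[of z q] by simp
next
  assume z: "z \<in> carrier L \<and> lr_less L p z \<and> lr_less L z q"
  then have zL: "z \<in> carrier L" and int: "pf R (snd z) < fst z" "fst z < pf S (snd z)"
    and inc: "\<not> p \<sqsubseteq> z" "\<not> z \<sqsubseteq> p"
    using lr_less_iff_RM[of p z] lr_less_iff_LM[of z q] by (auto simp: incomparable_def)
  \<comment> \<open>\<open>RM(p)\<close> and \<open>LM(q)\<close> meet at \<open>m\<close> and at
    \<open>j\<close>, so squeezing applies at both elements and makes \<open>z\<close> comparable
    with them.\<close>
  note sq = squeeze[OF RS(1,2) mj_in_R mj_in_S zL less_imp_le[OF int(1)] less_imp_le[OF int(2)]]
  have "\<not> j \<sqsubseteq> z" "\<not> z \<sqsubseteq> m"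
    using inc bounds le_trans[of p j z] le_trans[of z m p] zL mj_carrier by auto
  then have "z \<sqsubseteq> j" "m \<sqsubseteq> z"
    using sq[of j] sq[of m] linear[of "snd z" "snd j"] linear[of "snd z" "snd m"] by auto
  then show "z \<in> LocInt L p q"
    using zL int by (simp add: LocInt_def LocReg_iff chain_less_point_def point_less_chain_def)
qed

lemma covered_iff_LocInt_empty:
  "covered_by (carrier L) (lr_less L) p q \<longleftrightarrow> LocInt L p q = {}"
  using lr LocInt_iff_lr_between unfolding covered_by_def by (metis equals0I emptyE pq)

lemma LocReg_boundary:
  "LocInt L p q = {} \<longleftrightarrow> LocReg L p q \<subseteq> left_boundary L p q \<union> right_boundary L p q"
proof -
  have "z \<in> LocInt L p q \<longleftrightarrow> z \<notin> left_boundary L p q \<and> z \<notin> right_boundary L p q"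
    if "z \<in> LocReg L p q" for z
    using that in_chain_iff[OF RS(1), of z] in_chain_iff[OF RS(2), of z]
    by (auto simp: LocReg_iff LocInt_def left_boundary_def right_boundary_def
        chain_less_point_def point_less_chain_def)
  then show ?thesis
    by (auto simp: LocInt_def)
qed

section \<open>The boundaries as sides of an e-ladder\<close>

abbreviation A where "A \<equiv> left_boundary L p q"
abbreviation B where "B \<equiv> right_boundary L p q"

lemma opposite_chains_boundaries:
  "opposite_chains L A B p q m j" "opposite_chains L B A q p m j"
proof -
  have AB: "finite A" "finite B" "A \<subseteq> carrier L" "B \<subseteq> carrier L"
    using chains_finite[OF RS(1)] chains_finite[OF RS(2)] chains_subset[OF RS(1)]
      chains_subset[OF RS(2)] by (auto simp: left_boundary_def right_boundary_def)
  have tot: "\<And>x y. x \<in> A \<Longrightarrow> y \<in> A \<Longrightarrow> x \<sqsubseteq> y \<or> y \<sqsubseteq> x" "\<And>x y. x \<in> B \<Longrightarrow> y \<in> B \<Longrightarrow> x \<sqsubseteq> y \<or> y \<sqsubseteq> x"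
    using chains_total RS by (meson left_boundary_iff right_boundary_iff)+
  have mem: "p \<in> A" "m \<in> A" "j \<in> A" "q \<in> B" "m \<in> B" "j \<in> B"
    using RS mj_in_R mj_in_S bounds le_trans[of m p j] mj_carrier
    by (auto simp: left_boundary_iff right_boundary_iff)
  have lu: "\<And>x. x \<in> A \<union> B \<Longrightarrow> m \<sqsubseteq> x" "\<And>x. x \<in> A \<union> B \<Longrightarrow> x \<sqsubseteq> j"
    using left_boundary_iff right_boundary_iff by blast+
  have gl: "\<And>x. \<lbrakk>x \<in> carrier L; x \<sqsubseteq> p; x \<sqsubseteq> q\<rbrakk> \<Longrightarrow> x \<sqsubseteq> m"
    "\<And>x. \<lbrakk>x \<in> carrier L; p \<sqsubseteq> x; q \<sqsubseteq> x\<rbrakk> \<Longrightarrow> j \<sqsubseteq> x"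
    by (simp_all add: meet_le join_le)
  show "opposite_chains L A B p q m j"
    by unfold_locales (fact AB tot mem incomp bounds lu gl | blast intro: tot lu gl)+
  show "opposite_chains L B A q p m j"
    by unfold_locales (fact AB tot mem incomp bounds lu gl | blast intro: tot lu gl)+
qed

text \<open>Rungs ascending to the right belong to \<open>up\<close>, those ascending to the left to
  \<open>down\<close>, where the sides are exchanged.\<close>

sublocale up: opposite_chains L A B p q m j
  by (rule opposite_chains_boundaries)

sublocale down: opposite_chains L B A q p m j
  by (rule opposite_chains_boundaries)

lemma rungs_eq: "{(x, y). rung L p q x y} = up.up_rungs \<union> down.up_rungs"
  by (auto simp: rung_def up.up_rungs_def down.up_rungs_def)

lemma rungs_same_direction: "up.up_rungs = {} \<or> down.up_rungs = {}"
proof (rule ccontr)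
  assume "\<not> ?thesis"
  then obtain x y y' x' where r: "(x, y) \<in> up.up_rungs" "(y', x') \<in> down.up_rungs"
    by (metis equals0I surj_pair)
  show False
    using up.up_rungs_one_direction[OF r(1), of y' x'] down.up_rungsD[OF r(2)]
      down.up_rung_position[OF r(2)] by blast
qed

lemma LocInt_empty_iff_e_ladder: "LocInt L p q = {} \<longleftrightarrow> is_e_ladder L p q"
proof
  assume "is_e_ladder L p q"
  then obtain n f where f:
    "LocReg L p q - f ` carrier (C2_times_C n) \<subseteq> A \<union> B"
    "(\<forall>i<n. f (0, i) \<in> A \<and> f (1, i) \<in> B) \<or> (\<forall>i<n. f (0, i) \<in> B \<and> f (1, i) \<in> A)"
    unfolding is_e_ladder_def by (elim exE conjE) (rule that)
  \<comment> \<open>Both the copy and the additional elements are on the boundaries, so nothing is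
    left for the interior.\<close>
  then have "f ` carrier (C2_times_C n) \<subseteq> A \<union> B"
    by (intro image_C2_times_C_subset) blast
  then show "LocInt L p q = {}"
    using f(1) LocReg_boundary by blast
next
  assume "LocInt L p q = {}"
  then have reg: "LocReg L p q = A \<union> B"
    using LocReg_boundary by (auto simp: left_boundary_def right_boundary_def)
  have img: "f ` carrier (C2_times_C n) \<subseteq> LocReg L p q"
    if "\<And>i. i < n \<Longrightarrow> f (0, i) \<in> A \<union> B \<and> f (1, i) \<in> A \<union> B" for f n
    unfolding reg by (rule image_C2_times_C_subset) (rule that)
  \<comment> \<open>The instance for the other direction supplies the copy. In a cell both cases
    apply, and the construction yields just \<open>m\<close>, \<open>p\<close>, \<open>q\<close>,
    \<open>j\<close> with \<open>n = 2\<close>.\<close>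
  from rungs_same_direction show "is_e_ladder L p q"
  proof
    assume "down.up_rungs = {}"
    then have rungs: "{(x, y). rung L p q x y} = up.up_rungs"
      using rungs_eq by simp
    obtain n f where f: "n \<ge> 2" "order_emb (C2_times_C n) L f"
      "\<And>i. i < n \<Longrightarrow> f (0, i) \<in> A \<and> f (1, i) \<in> B"
      "up.up_rungs = {(f (0, i), f (1, i)) | i. 0 < i \<and> i + 1 < n}"
      using up.ladder_embedding by blast
    show ?thesis
      unfolding is_e_ladder_def rungs f(4)
      using f(1,2,3) img[of n f] reg by (intro exI[of _ n] exI[of _ f]) blast
  next
    assume "up.up_rungs = {}"
    then have rungs: "{(x, y). rung L p q x y} = down.up_rungs"
      using rungs_eq by simp
    obtain n f where f: "n \<ge> 2" "order_emb (C2_times_C n) L f"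
      "\<And>i. i < n \<Longrightarrow> f (0, i) \<in> B \<and> f (1, i) \<in> A"
      "down.up_rungs = {(f (0, i), f (1, i)) | i. 0 < i \<and> i + 1 < n}"
      using down.ladder_embedding by blast
    show ?thesis
      unfolding is_e_ladder_def rungs f(4)
      using f(1,2,3) img[of n f] reg by (intro exI[of _ n] exI[of _ f]) blast
  qed
qed

end

theorem theorem17:
  fixes L :: "point gorder" and p q :: point
  assumes "planar_lattice_diagram L"
    and "p \<in> carrier L" and "q \<in> carrier L" and "incomparable L p q"
    and "lr_less L p q"
  shows "(covered_by (carrier L) (lr_less L) p q \<longleftrightarrow> LocInt L p q = {}) \<and>
         (LocInt L p q = {} \<longleftrightarrow> is_e_ladder L p q)"
proof -
  interpret lattice L
    using assms(1) by (simp add: planar_lattice_diagram_def)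
  \<comment> \<open>The carrier is nonempty because it contains \<open>p\<close>.\<close>
  interpret local_region L p q
    by unfold_locales (use assms in \<open>auto simp: planar_lattice_diagram_def\<close>)
  show ?thesis
    using covered_iff_LocInt_empty LocInt_empty_iff_e_ladder by blast
qed

end
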